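(* Let $n\ge 1$ and let $I,J$ be ad-nilpotent ideals in $\mathfrak{gl}_{n+1}(\mathbb C)$ (type $A_n$). If $\mathcal O_I=\mathcal O_J$, then $I$ and $J$ are related by a (finite, possibly empty) sequence of basic moves (each performed in either direction). That is, the equivalence relation on the set of ad-nilpotent ideals generated by basic moves coincides with the equivalence relation given by having the same associated nilpotent orbit: $I\sim J$ if and only if $\mathcal O_I=\mathcal O_J$.
   Context: Let $G=GL_{n+1}(\mathbb C)$, let $B\subset G$ be the subgroup of upper triangular matrices and $\mathfrak n$ the space of strictly upper triangular matrices. An *ad-nilpotent ideal* (or just *ideal* ) is a linear subspace $I\subset\mathfrak n$ stable under conjugation by $B$. Let $t_{ij}$ be the matrix unit with $1$ in position $(i,j)$. For $1\le i\le j\le n$ let $[i,j]$ denote the positive root $\alpha_i+\cdots+\alpha_j=e_i-e_{j+1}$, where $\alpha_k=e_k-e_{k+1}$; its root space is spanned by $t_{i,j+1}$. Positive roots are partially ordered by $[i,j]\preceq[i',j']$ iff $i'\le i$ and $j\le j'$. Every ideal $I$ is the direct sum of the root spaces for the roots in a unique upper order ideal $\mathcal I$ of the poset of positive roots (its root ideal), and this gives a bijection between ideals and root ideals. Let $\mathcal I_{min}$ be the set of minimal elements of $\mathcal I$ (an antichain, which determines $\mathcal I$). For each ideal $I$, the set $G.I=\{gXg^{-1}: g\in G, X\in I\}$ is the closure of a single nilpotent conjugacy class, denoted $\mathcal O_I$ and called the associated nilpotent orbit of $I$. For $1\le j\le n$, $\mathcal I$ is called *$j$-stable* if $s_{\alpha_j}(\mathcal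 I)=\mathcal I$, where $s_{\alpha_j}$ interchanges $e_j$ and $e_{j+1}$; equivalently, no root in $\mathcal I_{min}$ is of the form $[j,b]$ or $[a,j]$. *Basic move*: if $[a,b]\in\mathcal I_{min}$ and either ($a\ge 2$ and $\mathcal I$ is $(a-1)$-stable) or ($b\le n-1$ and $\mathcal I$ is $(b+1)$-stable), then $\mathcal I$ and the root ideal $\mathcal J=\mathcal I\setminus\{[a,b]\}$ (and the corresponding ideals $I$ and $J$) are related by the basic move. The relation $\sim$ is the equivalence relation generated by basic moves. *)

theory Defs
  imports
    "HOL-Analysis.Abstract_Topology"
    "HOL-Analysis.Product_Topology"
    "HOL-Analysis.Function_Topology"
    "HOL-Combinatorics.Transposition"
    "Jordan_Normal_Form.Matrix"
begin

text \<open>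
  Throughout, \<open>N = n + 1\<close>. Matrices are numbered from \<open>0\<close> as in the library, whereas the
  indices of roots, of the functionals \<open>e\<^sub>1, \<dots>, e\<^bsub>n+1\<^esub>\<close> and of simple roots are numbered from \<open>1\<close>.
\<close>

subsection \<open>Nilpotent conjugacy classes\<close>

text \<open>The Euclidean topology on the \<open>N \<times> N\<close> complex matrices: that of the \<open>N\<^sup>2\<close> entries.\<close>

definition mat_topology :: "nat \<Rightarrow> complex mat topology" where
  "mat_topology N =
     pullback_topology (carrier_mat N N) (\<lambda>A. \<lambda>p \<in> {..<N} \<times> {..<N}. A $$ p)
       (product_topology (\<lambda>_. euclidean) ({..<N} \<times> {..<N}))"

definition nilpotent_mat :: "nat \<Rightarrow> complex mat \<Rightarrow> bool" where
  "nilpotent_mat N X \<longleftrightarrow> X \<in> carrier_mat N N \<and> (\<exists>k. X ^\<^sub>m k = 0\<^sub>m N N)"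

text \<open>The set \<open>G.S\<close> of all \<open>g X g\<inverse>\<close> with \<open>g\<close> invertible and \<open>X \<in> S\<close>.\<close>

definition conj_saturation :: "complex mat set \<Rightarrow> complex mat set" where
  "conj_saturation S = {Y. \<exists>X\<in>S. similar_mat Y X}"

definition nilpotent_class :: "nat \<Rightarrow> complex mat set \<Rightarrow> bool" where
  "nilpotent_class N C \<longleftrightarrow> (\<exists>X. nilpotent_mat N X \<and> C = conj_saturation {X})"

subsection \<open>Ad-nilpotent ideals and their orbits\<close>

definition strictly_upper_mats :: "nat \<Rightarrow> complex mat set" where
  "strictly_upper_mats N = {X \<in> carrier_mat N N. \<forall>p<N. \<forall>q\<le>p. X $$ (p, q) = 0}"

text \<open>
  The last conjunct is stability under \<open>B\<close>: \<open>similar_mat_wit Y X g h\<close> says that \<open>g\<close> and \<open>h\<close> are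
  mutually inverse and \<open>Y = g * X * h\<close>.
\<close>

definition ad_nilpotent_ideal :: "nat \<Rightarrow> complex mat set \<Rightarrow> bool" where
  "ad_nilpotent_ideal n I \<longleftrightarrow>
     I \<subseteq> strictly_upper_mats (n + 1) \<and>
     0\<^sub>m (n + 1) (n + 1) \<in> I \<and>
     (\<forall>X\<in>I. \<forall>Y\<in>I. X + Y \<in> I) \<and>
     (\<forall>c. \<forall>X\<in>I. c \<cdot>\<^sub>m X \<in> I) \<and>
     (\<forall>X\<in>I. \<forall>g h Y. upper_triangular g \<and> similar_mat_wit Y X g h \<longrightarrow> Y \<in> I)"

definition assoc_orbit :: "nat \<Rightarrow> complex mat set \<Rightarrow> complex mat set" where
  "assoc_orbit n I =
     (THE C. nilpotent_class (n + 1) C \<and> mat_topology (n + 1) closure_of C = conj_saturation I)"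

subsection \<open>Root ideals\<close>

text \<open>The pair \<open>(i, j)\<close> with \<open>1 \<le> i \<le> j \<le> n\<close> stands for the positive root
  \<open>[i, j] = e\<^sub>i - e\<^bsub>j+1\<^esub>\<close>.\<close>

definition pos_roots :: "nat \<Rightarrow> (nat \<times> nat) set" where
  "pos_roots n = {(i, j). 1 \<le> i \<and> i \<le> j \<and> j \<le> n}"

definition root_le :: "nat \<times> nat \<Rightarrow> nat \<times> nat \<Rightarrow> bool" where
  "root_le r s \<longleftrightarrow> fst s \<le> fst r \<and> snd r \<le> snd s"

definition root_ideal :: "nat \<Rightarrow> (nat \<times> nat) set \<Rightarrow> bool" where
  "root_ideal n R \<longleftrightarrow>
     R \<subseteq> pos_roots n \<and> (\<forall>r\<in>R. \<forall>s\<in>pos_roots n. root_le r s \<longrightarrow> s \<in> R)"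

definition min_roots :: "(nat \<times> nat) set \<Rightarrow> (nat \<times> nat) set" where
  "min_roots R = {r \<in> R. \<forall>s\<in>R. root_le s r \<longrightarrow> s = r}"

text \<open>
  The direct sum of the root spaces of the roots in \<open>R\<close>, i.e. the matrices supported on the
  positions of these roots. The root space of \<open>(i, j)\<close> is spanned by the matrix unit in row \<open>i\<close>
  and column \<open>j + 1\<close>, which is position \<open>(i - 1, j)\<close> when counting from \<open>0\<close>.
\<close>

definition root_space_sum :: "nat \<Rightarrow> (nat \<times> nat) set \<Rightarrow> complex mat set" where
  "root_space_sum n R =
     {X \<in> carrier_mat (n + 1) (n + 1).
        \<forall>p<n + 1. \<forall>q<n + 1. X $$ (p, q) \<noteq> 0 \<longrightarrow> (p + 1, q) \<in> R}"

text \<open>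
  The reflection interchanges \<open>e\<^sub>j\<close> and \<open>e\<^bsub>j+1\<^esub>\<close>, so it may send a positive root to a negative one.
  Here a root \<open>e\<^sub>p - e\<^sub>q\<close> is therefore represented by the pair \<open>(p, q)\<close> with \<open>p \<noteq> q\<close>.
\<close>

definition as_difference :: "nat \<times> nat \<Rightarrow> nat \<times> nat" where
  "as_difference r = (fst r, snd r + 1)"

definition simple_reflection :: "nat \<Rightarrow> nat \<times> nat \<Rightarrow> nat \<times> nat" where
  "simple_reflection j =
     map_prod (Transposition.transpose j (j + 1)) (Transposition.transpose j (j + 1))"

definition stable :: "nat \<Rightarrow> (nat \<times> nat) set \<Rightarrow> bool" where
  "stable j R \<longleftrightarrow> simple_reflection j ` as_difference ` R = as_difference ` R"

subsection \<open>Basic moves\<close>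

definition root_basic_move :: "nat \<Rightarrow> (nat \<times> nat) set \<Rightarrow> (nat \<times> nat) set \<Rightarrow> bool" where
  "root_basic_move n R S \<longleftrightarrow>
     root_ideal n R \<and>
     (\<exists>a b. (a, b) \<in> min_roots R \<and>
            (a \<ge> 2 \<and> stable (a - 1) R \<or> b + 1 \<le> n \<and> stable (b + 1) R) \<and>
            S = R - {(a, b)})"

definition basic_move :: "nat \<Rightarrow> complex mat set \<Rightarrow> complex mat set \<Rightarrow> bool" where
  "basic_move n I J \<longleftrightarrow>
     (\<exists>R S. root_basic_move n R S \<and> I = root_space_sum n R \<and> J = root_space_sum n S)"

end

theory Submission
  imports
    "HOL-Analysis.Topology_Euclidean_Space"
    Defs
    "Jordan_Normal_Form.Jordan_Normal_Form_Existence"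
begin

text \<open>
  A basic move does not change \<open>G.I\<close>: if \<open>\<I>\<close> is preserved by a simple reflection, then \<open>I\<close> is
  stable under the corresponding \<open>GL\<^sub>2\<close>, which can clear the entry at the root that is removed.
  So it suffices to connect every ideal by basic moves to the nilradical of a parabolic subalgebra
  with weakly decreasing block sizes \<open>k\<^sub>1 \<ge> k\<^sub>2 \<ge> \<dots>\<close>. Such a nilradical is determined by its orbit,
  because the maximal rank of \<open>X\<^sup>j\<close> on it is \<open>N - (k\<^sub>1 + \<dots> + k\<^sub>j)\<close>, where \<open>N = n + 1\<close>.

  A root ideal is encoded by the function \<open>f\<close> whose value at a column is the number of rows that
  the ideal meets in this column. Basic moves lower a value \<open>a\<close> of \<open>f\<close> at the first column \<open>q\<close> where
  it is attained, provided that \<open>f a = f (a - 1)\<close> and \<open>a - 1\<close> is not a value of \<open>f\<close>, or that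
  \<open>f (q + 1) = f q\<close> and \<open>q\<close> is not a value of \<open>f\<close>. If \<open>f\<close> is constant on an interval, then all
  values of \<open>f\<close> can be driven out of the interior of this interval, which splits off a diagonal
  block; and two adjacent blocks in the wrong order can be partly exchanged, which enlarges the
  first of them.

  The orbit itself is obtained from two facts about the sorted nilradicals. The saturation of an
  ideal is closed, since every invertible matrix is the product of a unitary and an upper
  triangular one and the unitary group is compact. It is the closure of the class of any
  element for which the ranks of all powers are maximal, since such elements are dense and
  nilpotent matrices are classified by the ranks of their powers.
\<close>

subsection \<open>Basic moves on Hessenberg functions\<close>

text \<open>\<open>f x < x\<close> encodes strict upper triangularity of column \<open>x\<close>
  (columns count from 1), and monotonicity encodes closure of the root ideal to the right. Upward
  closure is built in, since \<open>f x\<close> counts rows from the top.\<close>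

definition hess :: "nat \<Rightarrow> (nat \<Rightarrow> nat) \<Rightarrow> bool" where
  "hess n f \<longleftrightarrow> (\<forall>x\<in>{1..n + 1}. f x < x \<and> (\<forall>y\<in>{x..n + 1}. f x \<le> f y))"

definition roots_of :: "nat \<Rightarrow> (nat \<Rightarrow> nat) \<Rightarrow> (nat \<times> nat) set" where
  "roots_of n f = {(i, j). 1 \<le> i \<and> j \<le> n \<and> i \<le> f (j + 1)}"

definition hess_move :: "nat \<Rightarrow> (nat \<Rightarrow> nat) \<Rightarrow> (nat \<Rightarrow> nat) \<Rightarrow> bool" where
  "hess_move n f g \<longleftrightarrow>
     hess n f \<and> hess n g \<and> root_basic_move n (roots_of n f) (roots_of n g)"

abbreviation conn :: "nat \<Rightarrow> (nat \<Rightarrow> nat) \<Rightarrow> (nat \<Rightarrow> nat) \<Rightarrow> bool" where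
  "conn n \<equiv> equivclp (hess_move n)"

lemma hess_less: "hess n f \<Longrightarrow> 1 \<le> x \<Longrightarrow> x \<le> n + 1 \<Longrightarrow> f x < x"
  and hess_mono: "hess n f \<Longrightarrow> 1 \<le> x \<Longrightarrow> x \<le> y \<Longrightarrow> y \<le> n + 1 \<Longrightarrow> f x \<le> f y"
  by (auto simp: hess_def)

lemma hess_const:
  assumes "hess n f" "1 \<le> x" "x \<le> z" "z \<le> y" "y \<le> n + 1" "f x = f y"
  shows "f z = f x"
  using hess_mono[OF assms(1), of x z] hess_mono[OF assms(1), of z y] assms by simp

lemma root_ideal_roots_of:
  assumes "hess n f"
  shows "root_ideal n (roots_of n f)"
proof -
  have "r \<in> pos_roots n" if "r \<in> roots_of n f" for r
    using that hess_less[OF assms, of "snd r + 1"]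
    by (cases r) (auto simp: roots_of_def pos_roots_def)
  moreover have "s \<in> roots_of n f" if "r \<in> roots_of n f" "s \<in> pos_roots n" "root_le r s" for r s
    using that hess_mono[OF assms, of "snd r + 1" "snd s + 1"]
    by (cases r; cases s) (auto simp: roots_of_def pos_roots_def root_le_def)
  ultimately show ?thesis unfolding root_ideal_def by blast
qed

text \<open>Equal heights of columns \<open>j\<close> and \<open>j + 1\<close> allow these columns
  to be exchanged. That no column has height exactly \<open>j\<close> allows rows \<open>j\<close>
  and \<open>j + 1\<close> to be exchanged.\<close>

lemma stable_roots_of:
  assumes f: "hess n f" and j: "1 \<le> j" "j \<le> n" and eq: "f j = f (j + 1)"
    and no: "\<And>x. 1 \<le> x \<Longrightarrow> x \<le> n + 1 \<Longrightarrow> f x \<noteq> j"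
  shows "stable j (roots_of n f)"
proof -
  let ?t = "Transposition.transpose j (j + 1)"
  define D where "D = {(p, q). 1 \<le> p \<and> p \<le> f q \<and> 1 \<le> q \<and> q \<le> n + 1}"
  have D: "as_difference ` roots_of n f = D"
  proof (intro equalityI subsetI)
    fix r assume "r \<in> D"
    then obtain p q where r: "r = (p, q)" "1 \<le> p" "p \<le> f q" "1 \<le> q" "q \<le> n + 1"
      by (auto simp: D_def)
    then have "r = as_difference (p, q - 1)" "(p, q - 1) \<in> roots_of n f"
      by (auto simp: as_difference_def roots_of_def)
    then show "r \<in> as_difference ` roots_of n f" by blast
  qed (auto simp: as_difference_def roots_of_def D_def)
  have sub: "simple_reflection j r \<in> D" if "r \<in> D" for r
  proof -
    obtain p q where r: "r = (p, q)" "1 \<le> p" "p \<le> f q" "1 \<le> q" "q \<le> n + 1"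
      using \<open>r \<in> D\<close> by (auto simp: D_def)
    have "f (?t q) = f q"
      using eq by (auto simp: Transposition.transpose_def)
    moreover have "?t p \<le> f q"
      using r no[of q] by (auto simp: Transposition.transpose_def split: if_splits)
    ultimately show ?thesis
      using r j by (auto simp: D_def simple_reflection_def Transposition.transpose_def)
  qed
  have "simple_reflection j (simple_reflection j r) = r" for r
    by (cases r) (simp add: simple_reflection_def)
  then have "simple_reflection j ` D = D"
    using sub by (metis image_eqI image_subsetI subsetI subset_antisym)
  then show ?thesis by (simp add: stable_def D)
qed

text \<open>Lowering the corner at column \<open>q\<close> removes the minimal root
  \<open>(Suc a, q - 1)\<close>. The first alternative gives stability for \<open>a\<close>, just
  before the left end of this root, the second for \<open>q\<close>, just after its right
  end.\<close>

lemma conn_move: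
  assumes f: "hess n f" and q: "1 \<le> q" "q \<le> n + 1" "f q = Suc a" "f (q - 1) \<le> a"
    and move: "1 \<le> a \<and> f a = f (a + 1) \<and> (\<forall>x\<in>{1..n + 1}. f x \<noteq> a) \<or>
      q \<le> n \<and> f (q + 1) = Suc a \<and> (\<forall>x\<in>{1..n + 1}. f x \<noteq> q)"
  shows "conn n f (f(q := a))" "hess n (f(q := a))"
proof -
  have q2: "Suc a < q" using hess_less[OF f q(1,2)] q(3) by simp
  have le: "f x \<le> a" if "1 \<le> x" "x < q" for x
    using hess_mono[OF f, of x "q - 1"] that q by force
  show g: "hess n (f(q := a))"
    unfolding hess_def
  proof (intro ballI conjI)
    fix x y assume "x \<in> {1..n + 1}" "y \<in> {x..n + 1}"
    then show "(f(q := a)) x \<le> (f(q := a)) y"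
      using hess_mono[OF f, of x y] le[of x] q by auto
  qed (use q2 hess_less[OF f] in auto)
  have mem: "(Suc a, q - 1) \<in> min_roots (roots_of n f)"
  proof -
    have "s = (Suc a, q - 1)" if s: "s \<in> roots_of n f" "root_le s (Suc a, q - 1)" for s
    proof -
      obtain i j where ij: "s = (i, j)" "j \<le> n" "i \<le> f (Suc j)" "Suc a \<le> i" "j \<le> q - 1"
        using s by (cases s) (auto simp: roots_of_def root_le_def)
      have "\<not> Suc j < q" using le[of "Suc j"] ij by auto
      then have "Suc j = q" using ij q by simp
      then show ?thesis using ij q by auto
    qed
    then show ?thesis using q by (auto simp: min_roots_def roots_of_def)
  qed
  have "roots_of n (f(q := a)) = roots_of n f - {(Suc a, q - 1)}"
    using q by (auto simp: roots_of_def)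
  moreover have "Suc a \<ge> 2 \<and> stable (Suc a - 1) (roots_of n f) \<or>
      q - 1 + 1 \<le> n \<and> stable (q - 1 + 1) (roots_of n f)"
    using move
  proof
    assume m: "1 \<le> a \<and> f a = f (a + 1) \<and> (\<forall>x\<in>{1..n + 1}. f x \<noteq> a)"
    then have "stable a (roots_of n f)"
      using q2 q by (intro stable_roots_of[OF f]) auto
    then show ?thesis using m by auto
  next
    assume m: "q \<le> n \<and> f (q + 1) = Suc a \<and> (\<forall>x\<in>{1..n + 1}. f x \<noteq> q)"
    then have "stable q (roots_of n f)"
      using q by (intro stable_roots_of[OF f]) auto
    then show ?thesis using m q by auto
  qed
  ultimately have "root_basic_move n (roots_of n f) (roots_of n (f(q := a)))"
    unfolding root_basic_move_def using mem root_ideal_roots_of[OF f] by blast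
  then have "hess_move n f (f(q := a))"
    using f g by (simp add: hess_move_def)
  then show "conn n f (f(q := a))" by blast
qed

text \<open>The run of columns is lowered one by one from the left. When column \<open>z\<close> is
  lowered, column \<open>z + 1\<close> still has the old height and \<open>z\<close> is not a value,
  so the second kind of move applies. The last column stays behind, as it need not have an equal
  right neighbour.\<close>

lemma conn_lower:
  assumes f: "hess n f" and x0: "1 \<le> x0" "x0 \<le> y" "y \<le> n + 1"
    and v: "\<And>x. x0 \<le> x \<Longrightarrow> x \<le> y \<Longrightarrow> f x = Suc v" "f (x0 - 1) \<le> v"
    and no: "\<And>x z. 1 \<le> x \<Longrightarrow> x \<le> n + 1 \<Longrightarrow> f x = z \<Longrightarrow> x0 \<le> z \<Longrightarrow> z < y \<Longrightarrow> False"
  defines "g \<equiv> (\<lambda>x. if x0 \<le> x \<and> x < y then v else f x)"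
  shows "conn n f g \<and> hess n g"
proof -
  have v_less: "Suc v < x0"
    using hess_less[OF f, of x0] v(1)[of x0] x0 by simp
  define h where "h z = (\<lambda>x. if x0 \<le> x \<and> x < z then v else f x)" for z
  have "conn n f (h z) \<and> hess n (h z)" if "x0 \<le> z" "z \<le> y" for z
    using that
  proof (induction z rule: dec_induct)
    case base
    have "h x0 = f" by (auto simp: h_def)
    then show ?case using f by simp
  next
    case (step z)
    then have IH: "conn n f (h z)" "hess n (h z)" by simp_all
    have "h (Suc z) = (h z)(z := v)" using step by (auto simp: h_def fun_eq_iff)
    moreover have "h z (z - 1) \<le> v" using step v(2) by (cases "z = x0") (auto simp: h_def)
    moreover have "h z x \<noteq> z" if "1 \<le> x" "x \<le> n + 1" for x
      using no[OF that refl] step v_less by (auto simp: h_def)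
    moreover have "h z z = Suc v" "h z (z + 1) = Suc v" using step v(1) by (auto simp: h_def)
    ultimately have "conn n (h z) (h (Suc z)) \<and> hess n (h (Suc z))"
      using conn_move[OF IH(2), of z v] step x0 by auto
    then show ?case using IH(1) equivclp_trans by metis
  qed
  from this[of y] show ?thesis using x0 by (simp add: h_def g_def)
qed

text \<open>Raising is the first kind of move read backwards. At each height \<open>a\<close>
  passed, \<open>f a = f (a + 1)\<close> because \<open>f\<close> is constant from
  \<open>f y\<close> to \<open>e\<close>. Columns before \<open>y\<close> stay below
  \<open>f y\<close> and columns after it are at least \<open>e\<close>, so \<open>a\<close> is not
  a value once column \<open>y\<close> has height \<open>Suc a\<close>.\<close>

lemma conn_raise:
  assumes f: "hess n f" and y: "1 \<le> y" "y \<le> n + 1" and v: "1 \<le> f y" "f y \<le> e" "e < y"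
    and const: "f (f y) = f e"
    and less: "f (y - 1) < f y"
    and next_ge: "y \<le> n \<Longrightarrow> e \<le> f (y + 1)"
  shows "conn n f (f(y := e)) \<and> hess n (f(y := e))"
proof -
  have "conn n f (f(y := z)) \<and> hess n (f(y := z))" if "f y \<le> z" "z \<le> e" for z
    using that
  proof (induction z rule: dec_induct)
    case base
    then show ?case using f by simp
  next
    case (step a)
    let ?g = "f(y := Suc a)"
    have before: "f x < f y" if "1 \<le> x" "x < y" for x
      using hess_mono[OF f, of x "y - 1"] that y less by linarith
    have after: "e \<le> f x" if "y < x" "x \<le> n + 1" for x
      using hess_mono[OF f, of "y + 1" x] that next_ge by simp
    have g: "hess n ?g"
      unfolding hess_def
    proof (intro ballI conjI)
      fix x z assume "x \<in> {1..n + 1}" "z \<in> {x..n + 1}"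
      then show "?g x \<le> ?g z"
        using hess_mono[OF f, of x z] before[of x] after[of z] step by auto
    qed (use hess_less[OF f] step v in auto)
    have "f a = f (f y)"
      by (rule hess_const[OF f, of _ _ e]) (use step v y const in auto)
    moreover have "f (Suc a) = f (f y)"
      by (rule hess_const[OF f, of _ _ e]) (use step v y const in auto)
    ultimately have eq: "?g a = ?g (a + 1)" using step v by auto
    have no: "?g x \<noteq> a" if "x \<in> {1..n + 1}" for x
      using before[of x] after[of x] step that by (cases x y rule: linorder_cases) auto
    have "?g (y - 1) \<le> a" using less step y by auto
    then have "conn n ?g (f(y := a))"
      using conn_move(1)[OF g, of y a] y v step eq no by auto
    moreover have "conn n f (f(y := a))" using step by (simp add: fun_upd_def)
    ultimately show ?case using g by (metis equivclp_trans equivclp_sym)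
  qed
  then show ?thesis using v by simp
qed

text \<open>
  The values of \<open>f\<close> inside an interval on which \<open>f\<close> is constant can be pushed out of it. The
  columns of the largest such value \<open>v\<close> are lowered to \<open>v - 1\<close>, except for the last one, which
  is then free to move up. Lowering is possible once the interval of these columns, which
  lies further to the right, has been cleared in the same way.
\<close>

lemma conn_clear:
  assumes "hess n f" "1 \<le> q" "q \<le> e" "e \<le> n + 1" "f q = f e"
  shows "\<exists>g. conn n f g \<and> hess n g \<and> (\<forall>x\<le>e. g x = f x) \<and>
    (\<forall>x\<in>{1..n + 1}. g x < q \<or> e \<le> g x) \<and> (\<forall>x. min (f x) (q - 1) \<le> g x)"
  using assms
proof (induction "n + 1 - e" arbitrary: f q e rule: less_induct)
  case less
  note outer_hyps = less.hyps and qe = less.prems(2-4)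
  \<comment> \<open>The outer induction treats intervals with larger right end \<open>e\<close>
    first; the inner one counts the columns whose value still lies in
    \<open>{q..<e}\<close>.\<close>
  define m where "m f = card {x\<in>{1..n + 1}. q \<le> f x \<and> f x < e}" for f :: "nat \<Rightarrow> nat"
  have "\<exists>g. conn n f g \<and> hess n g \<and> (\<forall>x\<le>e. g x = f x) \<and>
      (\<forall>x\<in>{1..n + 1}. g x < q \<or> e \<le> g x) \<and> (\<forall>x. min (f x) (q - 1) \<le> g x)"
    if "hess n f" "f q = f e" for f
    using that
  proof (induction "m f" arbitrary: f rule: less_induct)
    case less
    note f = less.prems(1) and fqe = less.prems(2)
    define V where "V = {x\<in>{1..n + 1}. q \<le> f x \<and> f x < e}"
    show ?case
    proof (cases "V = {}")
      case True
      then have "\<forall>x\<in>{1..n + 1}. f x < q \<or> e \<le> f x" by (force simp: V_def)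
      then show ?thesis using f by (intro exI[of _ f]) auto
    next
      case False
      have finV: "finite V" by (simp add: V_def)
      \<comment> \<open>By monotonicity \<open>y\<close> also carries the largest value in
        \<open>{q..<e}\<close>, and all later columns have value at least \<open>e\<close>.\<close>
      define y where "y = Max V"
      define v where "v = f y"
      have "y \<in> V" using Max_in[OF finV False] by (simp add: y_def)
      then have y: "1 \<le> y" "y \<le> n + 1" "q \<le> v" "v < e" by (auto simp: V_def v_def)
      have above: "e \<le> f x" if "y < x" "x \<le> n + 1" for x
      proof (rule ccontr)
        assume "\<not> e \<le> f x"
        moreover have "v \<le> f x" using hess_mono[OF f, of y x] y that by (simp add: v_def)
        ultimately have "x \<in> V" using y that by (simp add: V_def)
        then have "x \<le> y" using Max_ge[OF finV] by (simp add: y_def)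
        then show False using that by simp
      qed
      define x0 where "x0 = (LEAST x. 1 \<le> x \<and> f x = v)"
      have x0: "1 \<le> x0 \<and> f x0 = v"
        unfolding x0_def by (rule LeastI[of _ y]) (use y in \<open>auto simp: v_def\<close>)
      have x0_le: "x0 \<le> y"
        unfolding x0_def by (rule Least_le) (use y in \<open>auto simp: v_def\<close>)
      \<comment> \<open>On \<open>{q..e}\<close> the function equals \<open>f q < q \<le> v\<close>,
        so the run with value \<open>v\<close> starts beyond \<open>e\<close>. The outer induction
        can thus clear the interval from \<open>x0\<close> to \<open>y\<close>, and its lower bound
        \<open>x0 - 1 \<ge> e\<close> protects the columns after \<open>y\<close>.\<close>
      have e_x0: "e < x0"
      proof (rule ccontr)
        assume "\<not> e < x0"
        then have "v \<le> f e" using hess_mono[OF f, of x0 e] x0 qe by simp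
        then show False using hess_less[OF f, of q] qe fqe y by simp
      qed
      have const: "f x = v" if "x0 \<le> x" "x \<le> y" for x
        using hess_const[OF f, of x0 x y] x0 that y by (simp add: v_def)
      have below: "f x < v" if "1 \<le> x" "x < x0" for x
      proof -
        have "f x \<le> v" using hess_mono[OF f, of x x0] that x0 x0_le y by simp
        moreover have "f x \<noteq> v" using not_less_Least[of x "\<lambda>x. 1 \<le> x \<and> f x = v"] that
          by (simp add: x0_def)
        ultimately show ?thesis by simp
      qed
      obtain g where g: "conn n f g" "hess n g" "\<And>x. x \<le> y \<Longrightarrow> g x = f x"
        "\<And>x. 1 \<le> x \<Longrightarrow> x \<le> n + 1 \<Longrightarrow> g x < x0 \<or> y \<le> g x" "\<And>x. min (f x) (x0 - 1) \<le> g x"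
      proof -
        have "\<exists>g. conn n f g \<and> hess n g \<and> (\<forall>x\<le>y. g x = f x) \<and>
          (\<forall>x\<in>{1..n + 1}. g x < x0 \<or> y \<le> g x) \<and> (\<forall>x. min (f x) (x0 - 1) \<le> g x)"
          by (rule outer_hyps) (use f x0 x0_le e_x0 y v_def in auto)
        then show thesis using that by auto
      qed
      have g_above: "e \<le> g x" if "y < x" "x \<le> n + 1" for x
        using g(5)[of x] above[OF that] e_x0 by simp
      \<comment> \<open>Once the rest of the run is lowered, column \<open>y\<close> stands strictly
        above its left neighbour and can be raised to \<open>e\<close>.\<close>
      define h where "h = (\<lambda>x. if x0 \<le> x \<and> x < y then v - 1 else g x)"
      have v: "1 \<le> v" using y qe by simp
      have "f (x0 - 1) < v" by (rule below) (use e_x0 qe in auto)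
      then have "conn n g h \<and> hess n h"
        unfolding h_def
      proof (intro conn_lower g(2))
        show "g x = Suc (v - 1)" if "x0 \<le> x" "x \<le> y" for x
          using that g(3)[of x] const[of x] v by simp
        show False if "1 \<le> x" "x \<le> n + 1" "g x = z" "x0 \<le> z" "z < y" for x z
          using g(4)[of x] that by simp
      qed (use x0 x0_le y g(3)[of "x0 - 1"] in auto)
      then have h: "conn n g h" "hess n h" by auto
      have h_y: "h y = v" using g(3) by (simp add: h_def v_def)
      have h_le: "h x = f x" if "x \<le> e" for x
        using that e_x0 x0_le g(3) by (simp add: h_def)
      have h_above: "e \<le> h x" if "y < x" "x \<le> n + 1" for x
        using that g_above x0_le by (simp add: h_def)
      define k where "k = h(y := e)"
      have "h (y - 1) < v"
      proof (cases "x0 \<le> y - 1")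
        case True
        then show ?thesis using v e_x0 by (simp add: h_def)
      next
        case False
        then have "f (y - 1) < v" using x0_le e_x0 qe by (intro below) auto
        then show ?thesis using False g(3)[of "y - 1"] by (simp add: h_def)
      qed
      moreover have "h v = h e"
        using hess_const[OF f, of q v e] qe y fqe h_le by simp
      ultimately have "conn n h k \<and> hess n k"
        unfolding k_def using conn_raise[OF h(2), of y e] y v h_y e_x0 x0_le h_above by auto
      then have k: "conn n f k" "hess n k"
        using g(1) h(1) by (auto intro: equivclp_trans)
      have k_le: "k x = f x" if "x \<le> e" for x
        using that h_le e_x0 x0_le by (simp add: k_def)
      have k_min: "min (f x) (q - 1) \<le> k x" for x
        using g(5)[of x] y e_x0 const qe by (auto simp: k_def h_def)
      \<comment> \<open>Column \<open>y\<close> leaves \<open>V\<close> and none enters it: lowered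
        columns belonged to \<open>V\<close> before, and columns after \<open>y\<close> keep values
        at least \<open>e\<close>.\<close>
      have "{x\<in>{1..n + 1}. q \<le> k x \<and> k x < e} \<subset> V"
      proof (rule psubsetI)
        show "{x\<in>{1..n + 1}. q \<le> k x \<and> k x < e} \<subseteq> V"
        proof
          fix x assume "x \<in> {x\<in>{1..n + 1}. q \<le> k x \<and> k x < e}"
          then have x: "1 \<le> x" "x \<le> n + 1" "q \<le> k x" "k x < e" by auto
          have "x < y"
            using x h_above[of x] by (cases x y rule: linorder_cases) (auto simp: k_def)
          then show "x \<in> V"
            using x const[of x] g(3)[of x] y by (auto simp: V_def k_def h_def split: if_splits)
        qed
        show "{x\<in>{1..n + 1}. q \<le> k x \<and> k x < e} \<noteq> V"
          using \<open>y \<in> V\<close> by (auto simp: k_def)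
      qed
      then have "m k < m f"
        using psubset_card_mono[OF finV] by (simp add: m_def V_def)
      moreover have "k q = k e" using k_le qe fqe by simp
      ultimately obtain l where l: "conn n k l" "hess n l" "\<forall>x\<le>e. l x = k x"
        "\<forall>x\<in>{1..n + 1}. l x < q \<or> e \<le> l x" "\<forall>x. min (k x) (q - 1) \<le> l x"
        using less.hyps[of k] k by blast
      have "min (f x) (q - 1) \<le> l x" for x
        using k_min[of x] l(5)[rule_format, of x] by simp
      then show ?thesis
        using l k k_le by (intro exI[of _ l]) (auto intro: equivclp_trans)
    qed
  qed
  then show ?case using less by blast
qed

section \<open>Sorting the diagonal blocks by basic moves\<close>

text \<open>Beyond column \<open>P\<close> the function is that of a block upper triangular
  nilradical with weakly decreasing block sizes; \<open>m\<close> bounds the size of the next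
  block.\<close>

inductive sorted_blocks :: "nat \<Rightarrow> nat \<Rightarrow> nat \<Rightarrow> (nat \<Rightarrow> nat) \<Rightarrow> bool" for N where
  Nil: "sorted_blocks N m N g"
| Cons: "1 \<le> k \<Longrightarrow> k \<le> m \<Longrightarrow> P + k \<le> N \<Longrightarrow> \<forall>x\<in>{P<..P + k}. g x = P \<Longrightarrow>
    sorted_blocks N k (P + k) g \<Longrightarrow> sorted_blocks N m P g"

lemma sorted_blocks_ge:
  assumes "sorted_blocks N m P g"
  shows "x \<in> {P<..N} \<Longrightarrow> P \<le> g x"
  using assms
proof (induction rule: sorted_blocks.induct)
  case (Cons k m P g)
  then show ?case by (cases "x \<le> P + k") auto
qed auto

text \<open>The second block is lowered one height per pass, from \<open>P + k\<close> down to
  \<open>P\<close>, each pass leaving its last column behind. After \<open>k\<close> passes its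
  first \<open>m - k\<close> columns have joined the first block, and the \<open>k\<close> columns
  left behind form the staircase \<open>x - m\<close>.\<close>

lemma conn_swap:
  assumes f: "hess n f" and k: "1 \<le> k" "k < m" and le: "P + k + m \<le> n + 1"
    and fP: "\<forall>x\<in>{P<..P + k}. f x = P" "\<forall>x\<in>{P + k<..P + k + m}. f x = P + k"
    and ge: "\<forall>x\<in>{P + k + m<..n + 1}. P + k + m \<le> f x"
  shows "\<exists>g. conn n f g \<and> hess n g \<and> (\<forall>x\<le>P. g x = f x) \<and> (\<forall>x\<in>{P<..P + m}. g x = P) \<and>
    (\<forall>x\<in>{P<..n + 1}. P \<le> g x)"
proof -
  define h where "h i = (\<lambda>x. if P + k < x \<and> x \<le> P + m + i then P + i
    else if P + m + i < x \<and> x \<le> P + k + m then x - m else f x)" for i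
  have "conn n f (h i) \<and> hess n (h i)" if "i \<le> k" for i
    using that
  proof (induction i rule: inc_induct)
    case base
    have "h k = f" using fP by (auto simp: h_def fun_eq_iff)
    then show ?case using f by simp
  next
    case (step i)
    have "h i = (\<lambda>x. if P + k + 1 \<le> x \<and> x < P + m + Suc i then P + i else h (Suc i) x)"
      using step k by (auto simp: h_def fun_eq_iff)
    moreover have "conn n (h (Suc i)) \<dots> \<and> hess n \<dots>"
    proof (rule conn_lower)
      fix x z assume x: "1 \<le> x" "x \<le> n + 1" "h (Suc i) x = z" and z: "P + k + 1 \<le> z" "z < P + m + Suc i"
      have "f x < x" using hess_less[OF f] x by simp
      moreover have "x \<in> {P<..P + k} \<Longrightarrow> f x = P" "P + k + m < x \<Longrightarrow> P + k + m \<le> f x"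
        using fP ge x by auto
      ultimately show False
        using x z k step
        by (cases "x \<le> P + k"; cases "x \<le> P + k + m") (auto simp: h_def split: if_splits)
    qed (use step k le fP in \<open>auto simp: h_def\<close>)
    ultimately show ?case using step by (auto intro: equivclp_trans)
  qed
  from this[of 0] have "conn n f (h 0)" "hess n (h 0)" by auto
  moreover have "P \<le> h 0 x" if "x \<in> {P<..n + 1}" for x
  proof -
    have "P + k + m < x \<Longrightarrow> P + k + m \<le> f x" "x \<in> {P<..P + k} \<Longrightarrow> f x = P" using fP ge that by auto
    then show ?thesis using that k by (auto simp: h_def not_le)
  qed
  ultimately show ?thesis
    using fP k by (intro exI[of _ "h 0"]) (auto simp: h_def)
qed

text \<open>The choice is greedy: \<open>k\<close> is the largest first block size reachable by
  moves that fix the columns up to \<open>P\<close>, and the recursion continues behind this block.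
  A larger next block would contradict maximality by \<open>conn_swap\<close>.\<close>

lemma conn_sorted_blocks:
  assumes "hess n f" "P \<le> n + 1" "\<forall>x\<in>{P<..n + 1}. P \<le> f x"
  shows "\<exists>g. conn n f g \<and> hess n g \<and> (\<forall>x\<in>{1..P}. g x = f x) \<and> sorted_blocks (n + 1) (n + 1) P g"
  using assms
proof (induction "n + 1 - P" arbitrary: P f rule: less_induct)
  case less
  note f = less.prems(1)
  show ?case
  proof (cases "P = n + 1")
    case True
    then show ?thesis using f by (intro exI[of _ f]) (auto intro: sorted_blocks.Nil)
  next
    case False
    then have P: "P < n + 1" using less.prems by simp
    define Q where "Q k \<longleftrightarrow> 1 \<le> k \<and> P + k \<le> n + 1 \<and> (\<exists>g. conn n f g \<and> hess n g \<and>
      (\<forall>x\<in>{1..P}. g x = f x) \<and> (\<forall>x\<in>{P<..n + 1}. P \<le> g x) \<and> (\<forall>x\<in>{P<..P + k}. g x = P))" for k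
    have "f (P + 1) = P"
      using hess_less[OF f, of "P + 1"] less.prems(3)[rule_format, of "P + 1"] P by simp
    then have "Q 1"
      unfolding Q_def using f P less.prems(3)
      by (intro conjI exI[of _ f]) (auto simp: le_Suc_eq)
    moreover have "\<forall>k. Q k \<longrightarrow> k \<le> n + 1" by (auto simp: Q_def)
    ultimately obtain k where k: "Q k" and k_max: "\<And>l. Q l \<Longrightarrow> l \<le> k"
      using GreatestI_nat[of Q 1 "n + 1"] Greatest_le_nat[of Q _ "n + 1"] by blast
    from k obtain g where k1: "1 \<le> k" "P + k \<le> n + 1" and g: "conn n f g" "hess n g"
      "\<And>x. x \<in> {1..P} \<Longrightarrow> g x = f x" "\<And>x. x \<in> {P<..n + 1} \<Longrightarrow> P \<le> g x"
      "\<And>x. x \<in> {P<..P + k} \<Longrightarrow> g x = P"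
      unfolding Q_def by blast
    have "\<exists>h. conn n g h \<and> hess n h \<and> (\<forall>x\<le>P + k. h x = g x) \<and>
      (\<forall>x\<in>{1..n + 1}. h x < P + 1 \<or> P + k \<le> h x) \<and> (\<forall>x. min (g x) (P + 1 - 1) \<le> h x)"
      by (rule conn_clear) (use g k1 in auto)
    then obtain h where h: "conn n g h" "hess n h" "\<And>x. x \<le> P + k \<Longrightarrow> h x = g x"
      "\<And>x. x \<in> {1..n + 1} \<Longrightarrow> h x \<le> P \<or> P + k \<le> h x" "\<And>x. min (g x) P \<le> h x"
      by (auto simp: less_Suc_eq_le)
    have fh: "conn n f h" using g(1) h(1) by (rule equivclp_trans)
    have h_ge: "P \<le> h x" if "x \<in> {P<..n + 1}" for x
      using h(5)[of x] g(4)[OF that] by simp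
    \<comment> \<open>After clearing, a value below \<open>P + k\<close> is at most
      \<open>P\<close>. Column \<open>P + k + 1\<close> would then also have height
      \<open>P\<close>, which gives a first block of size \<open>k + 1\<close>.\<close>
    have h_ge': "P + k \<le> h x" if x: "x \<in> {P + k<..n + 1}" for x
    proof (rule ccontr)
      assume "\<not> P + k \<le> h x"
      then have "h x \<le> P" using h(4)[of x] x by auto
      moreover have "h (P + k + 1) \<le> h x" using hess_mono[OF h(2)] x by simp
      ultimately have "h (P + k + 1) = P" using h_ge[of "P + k + 1"] x by simp
      moreover have "h y = P" if "y \<in> {P<..P + k}" for y using h(3) g(5) that by simp
      ultimately have "\<forall>y\<in>{P<..P + (k + 1)}. h y = P"
        by (metis add.assoc Suc_eq_plus1 greaterThanAtMost_iff le_Suc_eq)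
      then have "Q (k + 1)"
        unfolding Q_def using x fh h h_ge g(3) by (intro conjI exI[of _ h]) auto
      then show False using k_max by fastforce
    qed
    have "n + 1 - (P + k) < n + 1 - P" using k1 P by simp
    from less.hyps[OF this h(2) k1(2)]
    obtain g' where g': "conn n h g'" "hess n g'" "\<And>x. x \<in> {1..P + k} \<Longrightarrow> g' x = h x"
      "sorted_blocks (n + 1) (n + 1) (P + k) g'"
      using h_ge' by blast
    have fg': "conn n f g'" using fh g'(1) by (rule equivclp_trans)
    have g'P: "\<forall>x\<in>{P<..P + k}. g' x = P" using g'(3) h(3) g(5) by simp
    have "sorted_blocks (n + 1) k (P + k) g'"
      using g'(4)
    proof cases
      case Nil
      then show ?thesis using sorted_blocks.Nil[of "n + 1" k g'] by simp
    next
      case (Cons m)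
      have "m \<le> k"
      proof (rule ccontr)
        assume "\<not> m \<le> k"
        then have "k < m" by simp
        moreover have "\<forall>x\<in>{P + k + m<..n + 1}. P + k + m \<le> g' x"
          using sorted_blocks_ge[OF Cons(5)] by blast
        ultimately obtain l where "conn n g' l" "hess n l" "\<forall>x\<le>P. l x = g' x"
          "\<forall>x\<in>{P<..P + m}. l x = P" "\<forall>x\<in>{P<..n + 1}. P \<le> l x"
          using conn_swap[OF g'(2) k1(1), of m P] Cons g'P by blast
        then have "Q m"
          unfolding Q_def using Cons fg' g'(3) h(3) g(3)
          by (intro conjI exI[of _ l]) (auto intro: equivclp_trans)
        then show False using k_max \<open>k < m\<close> by fastforce
      qed
      show ?thesis
        by (rule sorted_blocks.Cons[of m]) (use Cons \<open>m \<le> k\<close> in auto)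
    qed
    have "sorted_blocks (n + 1) (n + 1) P g'"
      by (rule sorted_blocks.Cons[of k]) (use k1 g'P \<open>sorted_blocks (n + 1) k (P + k) g'\<close> in auto)
    moreover have "\<forall>x\<in>{1..P}. g' x = f x" using g'(3) h(3) g(3) by simp
    ultimately show ?thesis using fg' g'(2) by blast
  qed
qed

subsection \<open>Ideals and conjugation by elementary matrices\<close>

text \<open>The conjugating pair is explicit because stability under the upper triangular group
  requires seeing that the conjugating matrix is triangular, as it is for
  \<open>k < l\<close>.\<close>

lemma add_col_sub_row_similar_wit:
  fixes A :: "'a :: comm_ring_1 mat"
  assumes A: "A \<in> carrier_mat n n" and kl: "k < n" "l < n" "k \<noteq> l"
  shows "similar_mat_wit (add_col_sub_row a k l A) A (addrow_mat n (-a) k l) (addrow_mat n a k l)"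
proof (rule similar_mat_witI)
  let ?P = "addrow_mat n (-a) k l" and ?Q = "addrow_mat n a k l"
  show "?Q * ?P = 1\<^sub>m n" by (rule addrow_mat_inv[OF kl])
  show "?P * ?Q = 1\<^sub>m n" using addrow_mat_inv[OF kl, of "-a"] by simp
  have "addcol a l k A = A * ?Q" by (rule addcol_mat[OF A kl(1)])
  then have "add_col_sub_row a k l A = ?P * (A * ?Q)"
    unfolding add_col_sub_row_def
    by (subst addrow_mat[of _ _ n]) (use A kl in auto)
  then show "add_col_sub_row a k l A = ?P * A * ?Q"
    using A by (subst assoc_mult_mat[of _ n n _ n _ n]) auto
qed (use A in auto)

lemma mult_col_div_row_similar_wit:
  fixes A :: "'a :: field mat"
  assumes A: "A \<in> carrier_mat n n" and k: "k < n" and a: "a \<noteq> 0"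
  shows "similar_mat_wit (mult_col_div_row a k A) A
    (multrow_mat n k (inverse a)) (multrow_mat n k a)"
proof (rule similar_mat_witI)
  let ?P = "multrow_mat n k (inverse a)" and ?Q = "multrow_mat n k a"
  show "?Q * ?P = 1\<^sub>m n" "?P * ?Q = 1\<^sub>m n"
    using multrow_mat_inv[OF k, of a] multrow_mat_inv[OF k, of "inverse a"] a by auto
  have "multcol k a A = A * ?Q" by (rule multcol_mat[OF A])
  then have "mult_col_div_row a k A = ?P * (A * ?Q)"
    unfolding mult_col_div_row_def
    by (subst multrow_mat[of _ _ n]) (use A in auto)
  then show "mult_col_div_row a k A = ?P * A * ?Q"
    using A by (subst assoc_mult_mat[of _ n n _ n _ n]) auto
qed (use A in auto)

abbreviation unit_mat :: "nat \<Rightarrow> nat \<Rightarrow> nat \<Rightarrow> complex mat" where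
  "unit_mat N p q \<equiv> mat N N (\<lambda>ij. if ij = (p, q) then 1 else 0)"

section \<open>Ad-nilpotent ideals are sums of root spaces\<close>

context
  fixes n :: nat and I :: "complex mat set"
  assumes I: "ad_nilpotent_ideal n I"
begin

lemma ideal_add: "X \<in> I \<Longrightarrow> Y \<in> I \<Longrightarrow> X + Y \<in> I"
  and ideal_smult: "X \<in> I \<Longrightarrow> c \<cdot>\<^sub>m X \<in> I"
  and ideal_conj: "X \<in> I \<Longrightarrow> upper_triangular g \<Longrightarrow> similar_mat_wit Y X g h \<Longrightarrow> Y \<in> I"
  and ideal_zero: "0\<^sub>m (n + 1) (n + 1) \<in> I"
  using I unfolding ad_nilpotent_ideal_def by blast+

lemma ideal_carrier: "X \<in> I \<Longrightarrow> X \<in> carrier_mat (n + 1) (n + 1)"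
  and ideal_strictly_upper: "X \<in> I \<Longrightarrow> p \<le> n \<Longrightarrow> q \<le> p \<Longrightarrow> X $$ (p, q) = 0"
  using I unfolding ad_nilpotent_ideal_def strictly_upper_mats_def by auto

lemma ideal_minus: "X \<in> I \<Longrightarrow> Y \<in> I \<Longrightarrow> X - Y \<in> I"
proof -
  assume XY: "X \<in> I" "Y \<in> I"
  have "X - Y = X + (-1) \<cdot>\<^sub>m Y"
    using ideal_carrier[OF XY(1)] ideal_carrier[OF XY(2)] by (intro eq_matI) auto
  then show ?thesis using XY ideal_add ideal_smult by simp
qed

lemma ideal_add_col_sub_row:
  assumes X: "X \<in> I" and "k < l" "l \<le> n"
  shows "add_col_sub_row a k l X \<in> I"
proof (rule ideal_conj[OF X])
  show "similar_mat_wit (add_col_sub_row a k l X) X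
      (addrow_mat (n + 1) (-a) k l) (addrow_mat (n + 1) a k l)"
    by (rule add_col_sub_row_similar_wit) (use assms ideal_carrier[OF X] in auto)
  show "upper_triangular (addrow_mat (n + 1) (-a) k l)"
    using assms by (auto simp: upper_triangular_def)
qed

lemma ideal_mult_col_div_row:
  assumes X: "X \<in> I" and "k \<le> n" "a \<noteq> 0"
  shows "mult_col_div_row a k X \<in> I"
proof (rule ideal_conj[OF X])
  show "similar_mat_wit (mult_col_div_row a k X) X
      (multrow_mat (n + 1) k (inverse a)) (multrow_mat (n + 1) k a)"
    by (rule mult_col_div_row_similar_wit) (use assms ideal_carrier[OF X] in auto)
  show "upper_triangular (multrow_mat (n + 1) k (inverse a))"
    using assms by (auto simp: upper_triangular_def)
qed

text \<open>Conjugation by the diagonal sign matrices isolates a single entry.\<close>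

lemma ideal_unit_mat:
  assumes X: "X \<in> I" and pq: "p \<le> n" "q \<le> n" "X $$ (p, q) \<noteq> 0"
  shows "unit_mat (n + 1) p q \<in> I"
proof -
  note car = ideal_carrier[OF X]
  have "p < q" using ideal_strictly_upper[OF X] pq by (meson not_le)
  then have qp: "X $$ (q, p) = 0" using ideal_strictly_upper[OF X] pq by simp
  \<comment> \<open>Conjugation by the sign matrix at \<open>p\<close> negates the off-diagonal
    entries of row and column \<open>p\<close>, so the difference keeps twice these. Repeating this
    with \<open>q\<close> leaves four times the entries \<open>(p, q)\<close> and
    \<open>(q, p)\<close>, and the latter is zero.\<close>
  define Y where "Y = X - mult_col_div_row (-1) p X"
  define Z where "Z = Y - mult_col_div_row (-1) q Y"
  have Y: "Y \<in> I"
    unfolding Y_def using X pq by (intro ideal_minus ideal_mult_col_div_row) auto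
  then have Z: "Z \<in> I"
    unfolding Z_def using pq by (intro ideal_minus ideal_mult_col_div_row) auto
  have "unit_mat (n + 1) p q = inverse (4 * X $$ (p, q)) \<cdot>\<^sub>m Z"
    using car pq qp \<open>p < q\<close> by (intro eq_matI) (auto simp: Z_def Y_def)
  then show ?thesis using ideal_smult[OF Z] by simp
qed

text \<open>An elementary conjugation adds row \<open>p\<close> to row \<open>p'\<close>. The
  accompanying column operation has no effect, since \<open>p' \<le> p < q\<close> makes both
  columns involved zero.\<close>

lemma ideal_unit_mat_up:
  assumes U: "unit_mat (n + 1) p q \<in> I" and "p' \<le> p" "p < q" "q \<le> n"
  shows "unit_mat (n + 1) p' q \<in> I"
proof (cases "p' = p")
  case False
  let ?U = "unit_mat (n + 1) p q"
  have "unit_mat (n + 1) p' q = add_col_sub_row (-1) p' p ?U - ?U"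
    using assms False by (intro eq_matI) auto
  moreover have "add_col_sub_row (-1) p' p ?U - ?U \<in> I"
    by (intro ideal_minus ideal_add_col_sub_row) (use assms False in auto)
  ultimately show ?thesis by simp
qed (use U in simp)

lemma ideal_unit_mat_right:
  assumes U: "unit_mat (n + 1) p q \<in> I" and "p < q" "q \<le> q'" "q' \<le> n"
  shows "unit_mat (n + 1) p q' \<in> I"
proof (cases "q' = q")
  case False
  let ?U = "unit_mat (n + 1) p q"
  have "unit_mat (n + 1) p q' = add_col_sub_row 1 q q' ?U - ?U"
    using assms False by (intro eq_matI) auto
  moreover have "add_col_sub_row 1 q q' ?U - ?U \<in> I"
    by (intro ideal_minus ideal_add_col_sub_row) (use assms False in auto)
  ultimately show ?thesis by simp
qed (use U in simp)

lemma ideal_contains_combination: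
  assumes X: "X \<in> carrier_mat (n + 1) (n + 1)"
    and units: "\<And>p q. p \<le> n \<Longrightarrow> q \<le> n \<Longrightarrow> X $$ (p, q) \<noteq> 0 \<Longrightarrow> unit_mat (n + 1) p q \<in> I"
  shows "X \<in> I"
proof -
  let ?part = "\<lambda>S. mat (n + 1) (n + 1) (\<lambda>ij. if ij \<in> S then X $$ ij else 0)"
  have "?part S \<in> I" if "finite S" "S \<subseteq> {..n} \<times> {..n}" for S
    using that
  proof (induction S rule: finite_induct)
    case empty
    have "?part {} = 0\<^sub>m (n + 1) (n + 1)" by (intro eq_matI) auto
    then show ?case using ideal_zero by simp
  next
    case (insert ij S)
    obtain p q where ij: "ij = (p, q)" by fastforce
    show ?case
    proof (cases "X $$ ij = 0")
      case True
      then have "?part (insert ij S) = ?part S" by (intro eq_matI) auto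
      then show ?thesis using insert by simp
    next
      case False
      have "?part (insert ij S) = ?part S + X $$ ij \<cdot>\<^sub>m unit_mat (n + 1) p q"
        using insert(2) by (intro eq_matI) (auto simp: ij)
      then show ?thesis
        using insert ideal_add[OF _ ideal_smult[OF units[of p q]]] False by (simp add: ij)
    qed
  qed
  moreover have "?part ({..n} \<times> {..n}) = X" using X by (intro eq_matI) auto
  ultimately show ?thesis by (metis finite_SigmaI finite_atMost subset_refl)
qed

lemma ideal_is_root_space_sum: "\<exists>R. root_ideal n R \<and> I = root_space_sum n R"
proof -
  define R where "R = {(i, j) \<in> pos_roots n. unit_mat (n + 1) (i - 1) j \<in> I}"
  have "s \<in> R" if "r \<in> R" "s \<in> pos_roots n" "root_le r s" for r s
  proof -
    obtain i j i' j' where rs: "r = (i, j)" "s = (i', j')" by fastforce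
    have "unit_mat (n + 1) (i' - 1) j \<in> I"
      by (rule ideal_unit_mat_up[of "i - 1"])
        (use that in \<open>auto simp: rs R_def pos_roots_def root_le_def\<close>)
    then have "unit_mat (n + 1) (i' - 1) j' \<in> I"
      by (rule ideal_unit_mat_right)
        (use that in \<open>auto simp: rs R_def pos_roots_def root_le_def\<close>)
    then show ?thesis using that by (auto simp: rs R_def)
  qed
  then have "root_ideal n R" unfolding root_ideal_def R_def by blast
  moreover have "I = root_space_sum n R"
  proof (intro equalityI subsetI)
    fix X assume X: "X \<in> I"
    have "(p + 1, q) \<in> R" if "p < n + 1" "q < n + 1" "X $$ (p, q) \<noteq> 0" for p q
    proof -
      have "p < q" using ideal_strictly_upper[OF X, of p q] that by (cases "q \<le> p") auto
      then show ?thesis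
        using ideal_unit_mat[OF X] that by (auto simp: R_def pos_roots_def)
    qed
    then show "X \<in> root_space_sum n R"
      using ideal_carrier[OF X] unfolding root_space_sum_def by blast
  next
    fix X assume X: "X \<in> root_space_sum n R"
    have "unit_mat (n + 1) p q \<in> I" if "p \<le> n" "q \<le> n" "X $$ (p, q) \<noteq> 0" for p q
    proof -
      have "(p + 1, q) \<in> R" using X that by (simp add: root_space_sum_def)
      then show ?thesis by (simp add: R_def)
    qed
    moreover have "X \<in> carrier_mat (n + 1) (n + 1)" using X by (simp add: root_space_sum_def)
    ultimately show "X \<in> I" by (rule ideal_contains_combination[rotated])
  qed
  ultimately show ?thesis by blast
qed

end

section \<open>Basic moves preserve the saturation\<close>

text \<open>Root indices count from 1 and matrix positions from 0: position \<open>(p, q)\<close>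
  carries the root \<open>(p + 1, q)\<close>, which is \<open>(p + 1, q + 1)\<close> in difference
  form. Exchanging \<open>j\<close> and \<open>j + 1\<close> therefore becomes exchanging
  \<open>j - 1\<close> and \<open>j\<close>.\<close>

lemma stable_iff:
  assumes "stable j R" "1 \<le> j"
  shows "(Transposition.transpose (j - 1) j p + 1, Transposition.transpose (j - 1) j q) \<in> R
    \<longleftrightarrow> (p + 1, q) \<in> R"
proof -
  let ?t = "Transposition.transpose (j - 1) j" and ?D = "as_difference ` R"
  have D: "(x + 1, y + 1) \<in> ?D \<longleftrightarrow> (x + 1, y) \<in> R" for x y
    by (force simp: as_difference_def)
  have refl: "simple_reflection j (x + 1, y + 1) = (?t x + 1, ?t y + 1)" for x y
    using assms(2) by (auto simp: simple_reflection_def Transposition.transpose_def)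
  have invol: "simple_reflection j (simple_reflection j z) = z" for z
    by (cases z) (simp add: simple_reflection_def)
  have "simple_reflection j z \<in> ?D \<longleftrightarrow> z \<in> ?D" for z
    using assms(1) invol unfolding stable_def by (metis image_eqI)
  from this[of "(p + 1, q + 1)"] show ?thesis unfolding refl D .
qed

text \<open>By the symmetry, rows \<open>k\<close> and \<open>l\<close> of the support agree, and so
  do its columns. No position with both indices in \<open>{k, l}\<close> is in the support, since
  its mirror image would be too and one of them is not above the diagonal. Combining these rows and
  columns thus stays within the support.\<close>

lemma add_col_sub_row_root_space_sum:
  assumes R: "R \<subseteq> pos_roots n" and X: "X \<in> root_space_sum n R"
    and kl: "k \<le> n" "l \<le> n" "k \<noteq> l"
    and sym: "\<And>p q. (Transposition.transpose k l p + 1, Transposition.transpose k l q) \<in> R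
      \<longleftrightarrow> (p + 1, q) \<in> R"
  shows "add_col_sub_row c k l X \<in> root_space_sum n R"
    "similar_mat (add_col_sub_row c k l X) X"
proof -
  have car: "X \<in> carrier_mat (n + 1) (n + 1)"
    and nz: "\<And>p q. p \<le> n \<Longrightarrow> q \<le> n \<Longrightarrow> X $$ (p, q) \<noteq> 0 \<Longrightarrow> (p + 1, q) \<in> R"
    using X by (auto simp: root_space_sum_def less_Suc_eq_le)
  have less: "(p + 1, q) \<in> R \<Longrightarrow> p < q" for p q
    using R by (auto simp: pos_roots_def)
  have no: "(p + 1, q) \<notin> R" if "{p, q} \<subseteq> {k, l}" for p q
    using sym[of p q] less[of p q] less[of "Transposition.transpose k l p" "Transposition.transpose k l q"] that
    by (auto simp: Transposition.transpose_def split: if_splits)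
  have zero: "X $$ (p, q) = 0" if "{p, q} \<subseteq> {k, l}" for p q
    using nz[of p q] no[OF that] kl that by auto
  have row: "(k + 1, q) \<in> R" if "(l + 1, q) \<in> R" for q
    using sym[of l q] no[of l q] that by (auto simp: Transposition.transpose_def split: if_splits)
  have col: "(p + 1, l) \<in> R" if "(p + 1, k) \<in> R" for p
    using sym[of p k] no[of p k] that by (auto simp: Transposition.transpose_def split: if_splits)
  have "(p + 1, q) \<in> R"
    if pq: "p \<le> n" "q \<le> n" and ne: "add_col_sub_row c k l X $$ (p, q) \<noteq> 0" for p q
  proof (rule ccontr)
    assume no': "(p + 1, q) \<notin> R"
    then have "X $$ (p, q) = 0" "p = k \<Longrightarrow> X $$ (l, q) = 0" "q = l \<Longrightarrow> X $$ (p, k) = 0"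
      using nz[of p q] nz[of l q] nz[of p k] row[of q] col[of p] pq kl by auto
    then show False
      using ne pq kl car zero[of k k] zero[of l k] zero[of l l] by (auto split: if_splits)
  qed
  then show "add_col_sub_row c k l X \<in> root_space_sum n R"
    using car by (auto simp: root_space_sum_def less_Suc_eq_le)
  show "similar_mat (add_col_sub_row c k l X) X"
    by (rule add_col_sub_row_similar[OF car]) (use kl in auto)
qed

text \<open>
  The reflection preserving \<open>R\<close> allows conjugation by all of \<open>GL\<^sub>2\<close> acting on the two coordinates
  involved, and the entry to be removed is cleared against its neighbour.
\<close>

lemma root_basic_move_conj:
  assumes move: "root_basic_move n R S" and X: "X \<in> root_space_sum n R"
  shows "\<exists>Y\<in>root_space_sum n S. similar_mat Y X"
proof -
  from move obtain a b where R: "R \<subseteq> pos_roots n" and ab: "(a, b) \<in> R"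
    and S: "S = R - {(a, b)}"
    and st: "a \<ge> 2 \<and> stable (a - 1) R \<or> b + 1 \<le> n \<and> stable (b + 1) R"
    unfolding root_basic_move_def root_ideal_def min_roots_def by blast
  have ab': "1 \<le> a" "a \<le> b" "b \<le> n" using ab R by (auto simp: pos_roots_def)
  have done': "Y \<in> root_space_sum n S" if "Y \<in> root_space_sum n R" "Y $$ (a - 1, b) = 0" for Y
    using that ab' by (auto simp: root_space_sum_def S)
  have car: "Y \<in> carrier_mat (n + 1) (n + 1)" if "Y \<in> root_space_sum n R" for Y
    using that by (auto simp: root_space_sum_def)
  show ?thesis
  proof (cases "X $$ (a - 1, b) = 0")
    case True
    then show ?thesis using done'[OF X] car[OF X] similar_mat_refl by blast
  next
    case False
    from st show ?thesis
    proof
      assume st: "a \<ge> 2 \<and> stable (a - 1) R"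
      have sym: "(Transposition.transpose (a - 2) (a - 1) p + 1,
          Transposition.transpose (a - 2) (a - 1) q) \<in> R \<longleftrightarrow> (p + 1, q) \<in> R" for p q
      proof -
        have "1 \<le> a - 1" "a - 1 - 1 = a - 2" using st by linarith+
        then show ?thesis using stable_iff[of "a - 1" R p q] st by simp
      qed
      note sym' = sym[unfolded transpose_commute[of "a - 2"]]
      have kl: "a - 2 \<le> n" "a - 1 \<le> n" "a - 2 \<noteq> a - 1" "a - 2 \<noteq> b" "a - 1 \<noteq> b" using st ab' by auto
      \<comment> \<open>The entry just above the one to be cleared serves as pivot; if it is zero,
        one conjugation makes it nonzero.\<close>
      obtain X' where X': "X' \<in> root_space_sum n R" "similar_mat X' X" "X' $$ (a - 2, b) \<noteq> 0"
      proof (cases "X $$ (a - 2, b) = 0")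
        case True
        let ?X = "add_col_sub_row 1 (a - 2) (a - 1) X"
        have "?X $$ (a - 2, b) \<noteq> 0" using True False kl ab' car[OF X] by auto
        then show ?thesis
          using that[of ?X] add_col_sub_row_root_space_sum[OF R X kl(1-3) sym] by simp
      next
        case False
        then show ?thesis using that[of X] X similar_mat_refl[OF car[OF X]] by simp
      qed
      let ?c = "X' $$ (a - 1, b) / X' $$ (a - 2, b)"
      let ?Y = "add_col_sub_row ?c (a - 1) (a - 2) X'"
      have "?Y $$ (a - 1, b) = 0" using X' kl ab' car[OF X'(1)] by simp
      moreover have "?Y \<in> root_space_sum n R" "similar_mat ?Y X'"
        using add_col_sub_row_root_space_sum[OF R X'(1) kl(2,1) kl(3)[symmetric] sym'] by auto
      ultimately show ?thesis using done' X'(2) similar_mat_trans by blast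
    next
      assume st: "b + 1 \<le> n \<and> stable (b + 1) R"
      have sym: "(Transposition.transpose b (b + 1) p + 1,
          Transposition.transpose b (b + 1) q) \<in> R \<longleftrightarrow> (p + 1, q) \<in> R" for p q
        using stable_iff[of "b + 1" R p q] st by simp
      note sym' = sym[unfolded transpose_commute[of b]]
      have kl: "b \<le> n" "b + 1 \<le> n" "b \<noteq> b + 1" "a - 1 \<noteq> b" "a - 1 \<noteq> b + 1" using st ab' by auto
      obtain X' where X': "X' \<in> root_space_sum n R" "similar_mat X' X" "X' $$ (a - 1, b + 1) \<noteq> 0"
      proof (cases "X $$ (a - 1, b + 1) = 0")
        case True
        let ?X = "add_col_sub_row 1 b (b + 1) X"
        have "?X $$ (a - 1, b + 1) \<noteq> 0" using True False kl ab' car[OF X] by auto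
        then show ?thesis
          using that[of ?X] add_col_sub_row_root_space_sum[OF R X kl(1-3) sym] by simp
      next
        case False
        then show ?thesis using that[of X] X similar_mat_refl[OF car[OF X]] by simp
      qed
      \<comment> \<open>The conjugation adds columns but subtracts rows, hence the sign opposite to
        the row case.\<close>
      let ?c = "- X' $$ (a - 1, b) / X' $$ (a - 1, b + 1)"
      let ?Y = "add_col_sub_row ?c (b + 1) b X'"
      have "?Y $$ (a - 1, b) = 0" using X' kl ab' car[OF X'(1)] by simp
      moreover have "?Y \<in> root_space_sum n R" "similar_mat ?Y X'"
        using add_col_sub_row_root_space_sum[OF R X'(1) kl(2,1) kl(3)[symmetric] sym'] by auto
      ultimately show ?thesis using done' X'(2) similar_mat_trans by blast
    qed
  qed
qed

lemma basic_move_conj_saturation: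
  assumes "basic_move n I J"
  shows "conj_saturation I = conj_saturation J"
proof -
  from assms obtain R S where move: "root_basic_move n R S"
    and IJ: "I = root_space_sum n R" "J = root_space_sum n S"
    unfolding basic_move_def by blast
  have "S \<subseteq> R" using move unfolding root_basic_move_def by blast
  then have "J \<subseteq> I" unfolding IJ root_space_sum_def by blast
  moreover have "\<exists>Y\<in>J. similar_mat Y X" if "X \<in> I" for X
    using root_basic_move_conj[OF move] that unfolding IJ by blast
  ultimately show ?thesis
    unfolding conj_saturation_def
    by (auto intro: similar_mat_trans dest: similar_mat_sym) (meson similar_mat_sym similar_mat_trans)
qed

lemma equivclp_conj_saturation:
  assumes "equivclp (basic_move n) I J"
  shows "conj_saturation I = conj_saturation J"
  using assms by (induction rule: equivclp_induct) (metis basic_move_conj_saturation)+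

subsection \<open>Ranks via minors\<close>

lemma index_mult_mat_sum:
  assumes "A \<in> carrier_mat a b" "B \<in> carrier_mat b c" "i < a" "j < c"
  shows "(A * B) $$ (i, j) = (\<Sum>s = 0..<b. A $$ (i, s) * B $$ (s, j))"
  using assms by (simp add: scalar_prod_def)

text \<open>Arbitrary rectangular \<open>P\<close> and \<open>Q\<close> generalise the selection of
  a minor: they absorb invertible factors, and nonvanishing of a determinant suits both limits and
  polynomial arguments.\<close>

definition rank_ge :: "nat \<Rightarrow> complex mat \<Rightarrow> bool" where
  "rank_ge r A \<longleftrightarrow> (\<exists>P\<in>carrier_mat r (dim_row A). \<exists>Q\<in>carrier_mat (dim_col A) r. det (P * A * Q) \<noteq> 0)"

definition has_rank :: "complex mat \<Rightarrow> nat \<Rightarrow> bool" where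
  "has_rank A c \<longleftrightarrow> rank_ge c A \<and> (\<forall>r. rank_ge r A \<longrightarrow> r \<le> c)"

lemma rank_geI:
  assumes "A \<in> carrier_mat N M" "P \<in> carrier_mat r N" "Q \<in> carrier_mat M r" "det (P * A * Q) \<noteq> 0"
  shows "rank_ge r A"
  unfolding rank_ge_def using assms by (metis carrier_matD)

lemma has_rank_unique: "has_rank A c \<Longrightarrow> has_rank A d \<Longrightarrow> c = d"
  unfolding has_rank_def using le_antisym by blast

lemma rank_ge_similar_wit:
  assumes A: "A \<in> carrier_mat N N" and sim: "similar_mat_wit A B g h" and rk: "rank_ge r A"
  shows "rank_ge r B"
proof -
  note w = similar_mat_witD2[OF A sim]
  obtain P Q where P: "P \<in> carrier_mat r N" and Q: "Q \<in> carrier_mat N r" and d: "det (P * A * Q) \<noteq> 0"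
    using rk A unfolding rank_ge_def by auto
  have "P * A * Q = (P * g) * B * (h * Q)"
    unfolding w(3) using w P Q by (simp add: assoc_mult_mat[of _ r N _ N _ N] assoc_mult_mat[of _ r N _ N _ r]
        assoc_mult_mat[of _ N N _ N _ N] assoc_mult_mat[of _ N N _ N _ r])
  then show ?thesis
    unfolding rank_ge_def using d w P Q by (metis carrier_matD mult_carrier_mat)
qed

lemma rank_ge_pow_similar:
  assumes "similar_mat A B" "A \<in> carrier_mat N N"
  shows "rank_ge r (A ^\<^sub>m k) \<longleftrightarrow> rank_ge r (B ^\<^sub>m k)"
proof -
  obtain g h where w: "similar_mat_wit A B g h" using assms unfolding similar_mat_def by blast
  have B: "B \<in> carrier_mat N N" using similar_mat_witD2[OF assms(2) w] by simp
  have A': "A ^\<^sub>m k \<in> carrier_mat N N" and B': "B ^\<^sub>m k \<in> carrier_mat N N" using assms B by auto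
  note wk = similar_mat_wit_pow[OF w, of k]
  show ?thesis
    using rank_ge_similar_wit[OF A' wk] rank_ge_similar_wit[OF B' similar_mat_wit_sym[OF wk]] by blast
qed

text \<open>Padding both factors by zeros to square matrices keeps the product, and the padded left
  factor kills a unit vector.\<close>

lemma det_mult_wide_zero:
  fixes U V :: "'a :: idom mat"
  assumes U: "U \<in> carrier_mat r c" and V: "V \<in> carrier_mat c r" and "c < r"
  shows "det (U * V) = 0"
proof -
  define U' where "U' = mat r r (\<lambda>(i, j). if j < c then U $$ (i, j) else 0)"
  define V' where "V' = mat r r (\<lambda>(i, j). if i < c then V $$ (i, j) else 0)"
  have carr: "U' \<in> carrier_mat r r" "V' \<in> carrier_mat r r" by (simp_all add: U'_def V'_def)
  have "U * V = U' * V'"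
  proof (rule eq_matI)
    fix i j assume "i < dim_row (U' * V')" "j < dim_col (U' * V')"
    then have ij: "i < r" "j < r" using carr by auto
    have "(\<Sum>s = 0..<r. U' $$ (i, s) * V' $$ (s, j)) = (\<Sum>s = 0..<c. U $$ (i, s) * V $$ (s, j))"
      by (rule sum.mono_neutral_cong_right) (use ij \<open>c < r\<close> in \<open>auto simp: U'_def V'_def\<close>)
    then show "(U * V) $$ (i, j) = (U' * V') $$ (i, j)"
      using ij U V carr by (simp add: scalar_prod_def)
  qed (use U V carr in auto)
  moreover have "det U' = 0"
  proof (subst det_0_iff_vec_prod_zero[OF carr(1)], intro exI conjI)
    show "U' *\<^sub>v unit_vec r c = 0\<^sub>v r"
      using \<open>c < r\<close> by (intro eq_vecI) (auto simp: U'_def)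
  qed (use \<open>c < r\<close> in auto)
  ultimately show ?thesis using det_mult[OF carr] by simp
qed

text \<open>The matrix factors through its columns in \<open>S\<close>, so any determinant of larger
  size is that of a product with too small an inner dimension.\<close>

lemma rank_ge_le_card:
  assumes A: "A \<in> carrier_mat N M" and S: "S \<subseteq> {..<M}"
    and zero: "\<And>i j. i < N \<Longrightarrow> j < M \<Longrightarrow> j \<notin> S \<Longrightarrow> A $$ (i, j) = 0"
    and rk: "rank_ge r A"
  shows "r \<le> card S"
proof (rule ccontr)
  assume "\<not> r \<le> card S"
  let ?c = "card S"
  have fin: "finite S" using S finite_subset by blast
  then obtain e where e: "bij_betw e {0..<?c} S" using ex_bij_betw_nat_finite by blast
  then have e_mem: "e j \<in> S" if "j < ?c" for j using that by (auto simp: bij_betw_def)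
  then have e_less: "e j < M" if "j < ?c" for j using that S by blast
  define B where "B = mat N ?c (\<lambda>(i, j). A $$ (i, e j))"
  define C where "C = mat ?c M (\<lambda>(i, j). if j = e i then 1 else 0 :: complex)"
  have carr: "B \<in> carrier_mat N ?c" "C \<in> carrier_mat ?c M" by (simp_all add: B_def C_def)
  have "A = B * C"
  proof (rule eq_matI)
    fix i j assume "i < dim_row (B * C)" "j < dim_col (B * C)"
    then have ij: "i < N" "j < M" using carr by auto
    have "(\<Sum>s = 0..<?c. B $$ (i, s) * C $$ (s, j)) =
        (\<Sum>s = 0..<?c. A $$ (i, e s) * (if j = e s then 1 else 0))"
      using ij by (intro sum.cong) (auto simp: B_def C_def)
    also have "\<dots> = (\<Sum>s\<in>S. A $$ (i, s) * (if j = s then 1 else 0))"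
      by (rule sum.reindex_bij_betw[OF e])
    also have "\<dots> = A $$ (i, j)" using zero[OF ij] fin by (auto simp: sum.delta if_distrib cong: if_cong)
    finally show "A $$ (i, j) = (B * C) $$ (i, j)"
      using ij carr by (simp add: scalar_prod_def)
  qed (use A carr in auto)
  moreover obtain P Q where P: "P \<in> carrier_mat r N" and Q: "Q \<in> carrier_mat M r"
    and d: "det (P * A * Q) \<noteq> 0"
    using rk A unfolding rank_ge_def by auto
  ultimately have "P * A * Q = (P * B) * (C * Q)"
    using carr by (simp add: assoc_mult_mat[of _ r N _ ?c _ M] assoc_mult_mat[of _ r N _ ?c _ r]
        assoc_mult_mat[of _ N ?c _ M _ r] assoc_mult_mat[of _ r N _ M _ r]
        assoc_mult_mat[of _ r ?c _ M _ r])
  moreover have "det ((P * B) * (C * Q)) = 0"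
    by (rule det_mult_wide_zero[of _ r ?c]) (use P Q carr \<open>\<not> r \<le> card S\<close> in auto)
  ultimately show False using d by simp
qed

text \<open>Selecting the columns in \<open>D\<close> and the rows \<open>\<sigma> j\<close> in
  matching order yields the identity matrix.\<close>

lemma rank_ge_partial_permutation:
  assumes M: "M \<in> carrier_mat N N" and D: "D \<subseteq> {..<N}" and \<sigma>: "\<And>j. j \<in> D \<Longrightarrow> \<sigma> j < N"
    and inj: "inj_on \<sigma> D"
    and entries: "\<And>i j. i < N \<Longrightarrow> j \<in> D \<Longrightarrow> M $$ (i, j) = (if i = \<sigma> j then 1 else 0)"
  shows "rank_ge (card D) M"
proof -
  let ?c = "card D"
  have fin: "finite D" using D finite_subset by blast
  then obtain e where e: "bij_betw e {0..<?c} D" using ex_bij_betw_nat_finite by blast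
  then have e_mem: "e j \<in> D" if "j < ?c" for j using that by (auto simp: bij_betw_def)
  have e_inj: "e i = e j \<longleftrightarrow> i = j" if "i < ?c" "j < ?c" for i j
    using e that by (auto simp: bij_betw_def inj_on_def)
  have e_less: "e j < N" if "j < ?c" for j using e_mem[OF that] D by blast
  define P where "P = mat ?c N (\<lambda>(i, j). if j = \<sigma> (e i) then 1 else 0 :: complex)"
  define Q where "Q = mat N ?c (\<lambda>(i, j). if i = e j then 1 else 0 :: complex)"
  have carr: "P \<in> carrier_mat ?c N" "Q \<in> carrier_mat N ?c" by (simp_all add: P_def Q_def)
  have "P * M * Q = 1\<^sub>m ?c"
  proof (rule eq_matI)
    fix i j assume "i < dim_row (1\<^sub>m ?c :: complex mat)" "j < dim_col (1\<^sub>m ?c :: complex mat)"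
    then have ij: "i < ?c" "j < ?c" by auto
    have PM: "(P * M) $$ (i, s) = M $$ (\<sigma> (e i), s)" if "s < N" for s
    proof -
      have "(P * M) $$ (i, s) = (\<Sum>t = 0..<N. P $$ (i, t) * M $$ (t, s))"
        using ij that carr M by (simp add: scalar_prod_def)
      also have "\<dots> = (\<Sum>t = 0..<N. if t = \<sigma> (e i) then M $$ (t, s) else 0)"
        using ij by (intro sum.cong) (auto simp: P_def)
      finally show ?thesis using \<sigma>[OF e_mem[OF ij(1)]] by simp
    qed
    have "(P * M * Q) $$ (i, j) = (\<Sum>s = 0..<N. (P * M) $$ (i, s) * Q $$ (s, j))"
      by (rule index_mult_mat_sum) (use carr M ij in auto)
    also have "\<dots> = (\<Sum>s = 0..<N. if s = e j then M $$ (\<sigma> (e i), s) else 0)"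
      using ij by (intro sum.cong) (auto simp: Q_def PM)
    also have "\<dots> = M $$ (\<sigma> (e i), e j)" using e_less[OF ij(2)] by simp
    also have "\<dots> = (if i = j then 1 else 0)"
      using entries[OF \<sigma>[OF e_mem[OF ij(1)]] e_mem[OF ij(2)]] e_inj[OF ij] inj e_mem ij
      by (auto simp: inj_on_def)
    finally show "(P * M * Q) $$ (i, j) = 1\<^sub>m ?c $$ (i, j)" using ij by simp
  qed (use carr in auto)
  then show ?thesis
    unfolding rank_ge_def using carr M by (metis carrier_matD det_one zero_neq_one)
qed

subsection \<open>Nilpotent matrices are classified by the ranks of their powers\<close>

lemma similar_four_block_swap:
  fixes A B :: "'a :: comm_ring_1 mat"
  assumes A: "A \<in> carrier_mat n n" and B: "B \<in> carrier_mat m m"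
  shows "similar_mat (four_block_mat A (0\<^sub>m n m) (0\<^sub>m m n) B) (four_block_mat B (0\<^sub>m m n) (0\<^sub>m n m) A)"
proof (rule similar_matI)
  let ?P = "four_block_mat (0\<^sub>m n m) (1\<^sub>m n) (1\<^sub>m m) (0\<^sub>m m n) :: 'a mat"
  let ?Q = "four_block_mat (0\<^sub>m m n) (1\<^sub>m m) (1\<^sub>m n) (0\<^sub>m n m) :: 'a mat"
  let ?L = "four_block_mat A (0\<^sub>m n m) (0\<^sub>m m n) B" and ?R = "four_block_mat B (0\<^sub>m m n) (0\<^sub>m n m) A"
  have one: "four_block_mat (1\<^sub>m a) (0\<^sub>m a b) (0\<^sub>m b a) (1\<^sub>m b) = (1\<^sub>m (a + b) :: 'a mat)" for a b
    by (rule four_block_one_mat)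
  show "{?L, ?R, ?P, ?Q} \<subseteq> carrier_mat (n + m) (n + m)"
    using A B by auto
  show "?P * ?Q = 1\<^sub>m (n + m)"
    by (subst mult_four_block_mat[of _ n m _ n _ m _ _ n _ m]) (auto simp: one)
  show "?Q * ?P = 1\<^sub>m (n + m)"
    by (subst mult_four_block_mat[of _ m n _ m _ n _ _ m _ n]) (auto simp: one add.commute)
  have "?P * ?R = four_block_mat (0\<^sub>m n m) A B (0\<^sub>m m n)"
    using A B by (subst mult_four_block_mat[of _ n m _ n _ m _ _ m _ n]) auto
  also have "\<dots> * ?Q = ?L"
    using A B by (subst mult_four_block_mat[of _ n m _ n _ m _ _ n _ m]) auto
  finally show "?L = ?P * ?R * ?Q" by simp
qed

lemma jordan_matrix_append:
  "jordan_matrix (xs @ ys) = (let n = sum_list (map fst xs); m = sum_list (map fst ys) in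
    four_block_mat (jordan_matrix xs) (0\<^sub>m n m) (0\<^sub>m m n) (jordan_matrix ys))"
proof -
  have "jordan_matrix (xs @ ys) = (let A = jordan_matrix xs; B = jordan_matrix ys in
      four_block_mat A (0\<^sub>m (dim_row A) (dim_col B)) (0\<^sub>m (dim_row B) (dim_col A)) B)"
    unfolding jordan_matrix_def map_append diag_block_mat_append ..
  then show ?thesis by (simp add: Let_def)
qed

lemma similar_jordan_matrix_append:
  fixes xs :: "(nat \<times> 'a :: comm_ring_1) list"
  assumes "similar_mat (jordan_matrix xs) (jordan_matrix xs')"
    and "similar_mat (jordan_matrix ys) (jordan_matrix ys')"
  shows "similar_mat (jordan_matrix (xs @ ys)) (jordan_matrix (xs' @ ys'))"
proof -
  have "sum_list (map fst xs) = sum_list (map fst xs')" "sum_list (map fst ys) = sum_list (map fst ys')"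
    using similar_matD[OF assms(1)] similar_matD[OF assms(2)]
    by (metis carrier_matD(1) insert_subset jordan_matrix_dim(1))+
  then show ?thesis
    unfolding jordan_matrix_append Let_def
    using similar_mat_four_block_0_0[OF assms jordan_matrix_carrier jordan_matrix_carrier] by metis
qed

text \<open>Exchanging two adjacent groups of blocks, a conjugation by a block permutation, brings
  the leading block to its place in \<open>ys\<close>.\<close>

lemma similar_jordan_matrix_mset:
  fixes xs :: "(nat \<times> 'a :: comm_ring_1) list"
  assumes "mset xs = mset ys"
  shows "similar_mat (jordan_matrix xs) (jordan_matrix ys)"
  using assms
proof (induction xs arbitrary: ys)
  case Nil
  then show ?case using similar_mat_refl[OF jordan_matrix_carrier] by simp
next
  case (Cons x xs)
  note refl = similar_mat_refl[OF jordan_matrix_carrier]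
  have "x \<in> set ys" using Cons.prems by (metis list.set_intros(1) set_mset_mset)
  then obtain u v where ys: "ys = u @ x # v" by (meson split_list)
  then have "mset xs = mset (u @ v)" using Cons.prems by simp
  then have "similar_mat (jordan_matrix ([x] @ xs)) (jordan_matrix ([x] @ (u @ v)))"
    by (intro similar_jordan_matrix_append refl Cons.IH)
  moreover have "similar_mat (jordan_matrix ([x] @ u)) (jordan_matrix (u @ [x]))"
    unfolding jordan_matrix_append Let_def
    by (rule similar_four_block_swap[OF jordan_matrix_carrier jordan_matrix_carrier])
  then have "similar_mat (jordan_matrix (([x] @ u) @ v)) (jordan_matrix ((u @ [x]) @ v))"
    by (rule similar_jordan_matrix_append[OF _ refl])
  ultimately show ?case using similar_mat_trans by (fastforce simp: ys)
qed

text \<open>The \<open>k\<close>-th power of a nilpotent block has ones exactly on its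
  \<open>k\<close>-th superdiagonal. \<open>D\<close> collects the columns at least \<open>k\<close>
  places into their block, whose number in a block of size \<open>n\<close> is the truncated
  \<open>n - k\<close>.\<close>

lemma jordan_matrix_zero_pow:
  fixes ns :: "(nat \<times> complex) list"
  assumes "\<forall>(n, a)\<in>set ns. a = 0"
  shows "\<exists>D. D \<subseteq> {k..<sum_list (map fst ns)} \<and> card D = (\<Sum>(n, a)\<leftarrow>ns. n - k) \<and>
    jordan_matrix ns ^\<^sub>m k = mat (sum_list (map fst ns)) (sum_list (map fst ns))
      (\<lambda>(i, j). if j \<in> D \<and> i + k = j then 1 else 0)"
  using assms
proof (induction ns)
  case Nil
  show ?case by (intro exI[of _ "{}"]) (auto simp: jordan_matrix_pow intro!: eq_matI)
next
  case (Cons x ns)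
  obtain n where x: "x = (n, 0)" using Cons.prems by (cases x) auto
  let ?N = "sum_list (map fst ns)"
  obtain D where D: "D \<subseteq> {k..<?N}" "card D = (\<Sum>(n, a)\<leftarrow>ns. n - k)"
    "jordan_matrix ns ^\<^sub>m k = mat ?N ?N (\<lambda>(i, j). if j \<in> D \<and> i + k = j then 1 else 0)"
    using Cons by auto
  define E where "E = {k..<n} \<union> (+) n ` D"
  have "E \<subseteq> {k..<n + ?N}" using D(1) by (auto simp: E_def)
  moreover have "card E = (n - k) + card D"
  proof -
    have "card ((+) n ` D) = card D" by (rule card_image) simp
    moreover have "finite D" using D(1) finite_subset by blast
    ultimately show ?thesis unfolding E_def by (subst card_Un_disjoint) auto
  qed
  moreover have "jordan_matrix (x # ns) ^\<^sub>m k =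
      four_block_mat (jordan_block n 0 ^\<^sub>m k) (0\<^sub>m n ?N) (0\<^sub>m ?N n) (jordan_matrix ns ^\<^sub>m k)"
  proof -
    have "diag_block_mat (map (\<lambda>(n, a). jordan_block n a ^\<^sub>m k) ns) \<in> carrier_mat ?N ?N"
      unfolding jordan_matrix_pow[symmetric] by simp
    then show ?thesis by (simp add: x jordan_matrix_pow Let_def)
  qed
  then have "jordan_matrix (x # ns) ^\<^sub>m k =
      mat (n + ?N) (n + ?N) (\<lambda>(i, j). if j \<in> E \<and> i + k = j then 1 else 0)"
  proof (rule trans, intro eq_matI)
    fix i j
    assume "i < dim_row (mat (n + ?N) (n + ?N) (\<lambda>(i, j). if j \<in> E \<and> i + k = j then 1 else 0 :: complex))"
      "j < dim_col (mat (n + ?N) (n + ?N) (\<lambda>(i, j). if j \<in> E \<and> i + k = j then 1 else 0 :: complex))"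
    then have ij: "i < n + ?N" "j < n + ?N" by auto
    show "four_block_mat (jordan_block n 0 ^\<^sub>m k) (0\<^sub>m n ?N) (0\<^sub>m ?N n) (jordan_matrix ns ^\<^sub>m k) $$ (i, j) =
      mat (n + ?N) (n + ?N) (\<lambda>(i, j). if j \<in> E \<and> i + k = j then 1 else 0) $$ (i, j)"
    proof (cases "j < n")
      case True
      then have "j \<in> E \<longleftrightarrow> k \<le> j" by (auto simp: E_def)
      then show ?thesis using ij True by (auto simp: jordan_block_zero_pow)
    next
      case False
      then have "j \<in> E \<longleftrightarrow> j - n \<in> D" by (force simp: E_def)
      moreover have "n + k \<le> j" if "j - n \<in> D"
      proof -
        have "k \<le> j - n" using subsetD[OF D(1) that] by simp
        then show ?thesis using False by linarith
      qed
      ultimately show ?thesis using ij False by (auto simp: D(3))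
    qed
  qed auto
  ultimately show ?case using D(2) by (intro exI[of _ E]) (auto simp: x)
qed

lemma has_rank_jordan_matrix_zero_pow:
  fixes ns :: "(nat \<times> complex) list"
  assumes "\<forall>(n, a)\<in>set ns. a = 0"
  shows "has_rank (jordan_matrix ns ^\<^sub>m k) (\<Sum>(n, a)\<leftarrow>ns. n - k)"
proof -
  let ?N = "sum_list (map fst ns)" and ?J = "jordan_matrix ns ^\<^sub>m k"
  obtain D where D: "D \<subseteq> {k..<?N}" "card D = (\<Sum>(n, a)\<leftarrow>ns. n - k)"
    "?J = mat ?N ?N (\<lambda>(i, j). if j \<in> D \<and> i + k = j then 1 else 0)"
    using jordan_matrix_zero_pow[OF assms] by blast
  have car: "?J \<in> carrier_mat ?N ?N" by simp
  have sub: "D \<subseteq> {..<?N}" using D(1) by auto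
  have "rank_ge (card D) ?J"
  proof (rule rank_ge_partial_permutation[OF car sub])
    show "inj_on (\<lambda>j. j - k) D" using D(1) by (auto simp: inj_on_def subset_iff) (metis le_add_diff_inverse)
    show "?J $$ (i, j) = (if i = j - k then 1 else 0)" if "i < ?N" "j \<in> D" for i j
      using that D(1) unfolding D(3) by auto
    show "j - k < ?N" if "j \<in> D" for j
      using that sub by (meson lessThan_iff less_imp_diff_less subsetD)
  qed
  moreover have "r \<le> card D" if "rank_ge r ?J" for r
    by (rule rank_ge_le_card[OF car sub _ that]) (auto simp: D(3))
  ultimately show ?thesis unfolding has_rank_def D(2) by blast
qed

text \<open>Jordan blocks have positive size, so each \<open>a\<close> is an eigenvalue; a vanishing
  power of \<open>A\<close>, applied to an eigenvector, forces \<open>a = 0\<close>.\<close>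

lemma nilpotent_jordan_nf:
  assumes "nilpotent_mat N A"
  obtains ns where "jordan_nf A ns" "\<forall>(n, a)\<in>set ns. a = 0"
proof -
  obtain k where A: "A \<in> carrier_mat N N" and k: "A ^\<^sub>m k = 0\<^sub>m N N"
    using assms unfolding nilpotent_mat_def by blast
  obtain as where "char_poly A = (\<Prod>a\<leftarrow>as. [:- a, 1:])" using char_poly_factorized[OF A] by blast
  then obtain ns where jnf: "jordan_nf A ns" using jordan_nf_exists[OF A] by blast
  have "a = 0" if mem: "(n, a) \<in> set ns" for n a
  proof -
    have "n \<noteq> 0" using jnf mem unfolding jordan_nf_def by force
    then have "poly (char_poly A) a = 0"
      unfolding jordan_nf_char_poly[OF jnf] poly_prod_list prod_list_zero_iff
      using mem by (force simp: poly_power)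
    then obtain v where v: "eigenvector A v a"
      using eigenvalue_root_char_poly[OF A] unfolding eigenvalue_def by blast
    then have v': "v \<in> carrier_vec N" "v \<noteq> 0\<^sub>v N" using A unfolding eigenvector_def by auto
    have "0\<^sub>m N N *\<^sub>v v = 0\<^sub>v N" using v'(1) by (intro eq_vecI) auto
    then have "a ^ k \<cdot>\<^sub>v v = 0\<^sub>v N" using eigenvector_pow[OF A v, of k, unfolded k] by metis
    moreover obtain i where "i < N" "v $ i \<noteq> 0" using v' by (metis carrier_vecD eq_vecI index_zero_vec)
    ultimately show "a = 0" using v'(1)
      by (metis carrier_vecD index_smult_vec(1) index_zero_vec(1) mult_eq_0_iff power_eq_0_iff)
  qed
  then show thesis using that jnf by blast
qed

text \<open>As a function of \<open>k\<close>, the truncated \<open>x - k\<close> has second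
  difference 1 if \<open>x = k + 1\<close> and 0 otherwise.\<close>

lemma sum_list_truncated_diff:
  fixes xs :: "nat list"
  shows "(\<Sum>x\<leftarrow>xs. x - k) + (\<Sum>x\<leftarrow>xs. x - Suc (Suc k)) =
    2 * (\<Sum>x\<leftarrow>xs. x - Suc k) + count (mset xs) (Suc k)"
  by (induction xs) auto

text \<open>Multiplicities of positive sizes are second differences of the sums. The sums do not see
  the size 0, which is excluded by assumption.\<close>

lemma mset_eq_of_truncated_sums:
  fixes xs ys :: "nat list"
  assumes "0 \<notin> set xs" "0 \<notin> set ys" and "\<And>k. (\<Sum>x\<leftarrow>xs. x - k) = (\<Sum>y\<leftarrow>ys. y - k)"
  shows "mset xs = mset ys"
proof (rule multiset_eqI)
  fix m
  show "count (mset xs) m = count (mset ys) m"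
  proof (cases m)
    case 0
    then show ?thesis using assms(1,2) by (metis count_mset_0_iff)
  next
    case (Suc k)
    then show ?thesis
      using sum_list_truncated_diff[of k xs] sum_list_truncated_diff[of k ys] assms(3) by simp
  qed
qed

lemma nilpotent_similar_of_ranks:
  assumes A: "nilpotent_mat N A" and B: "nilpotent_mat N B"
    and ranks: "\<And>k. \<exists>c. has_rank (A ^\<^sub>m k) c \<and> has_rank (B ^\<^sub>m k) c"
  shows "similar_mat A B"
proof -
  obtain xs where xs: "jordan_nf A xs" "\<forall>(n, a)\<in>set xs. a = 0" using nilpotent_jordan_nf[OF A] .
  obtain ys where ys: "jordan_nf B ys" "\<forall>(n, a)\<in>set ys. a = 0" using nilpotent_jordan_nf[OF B] .
  have sim: "similar_mat A (jordan_matrix xs)" "similar_mat B (jordan_matrix ys)"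
    using xs(1) ys(1) unfolding jordan_nf_def by auto
  have rank: "has_rank (C ^\<^sub>m k) c \<longleftrightarrow> c = (\<Sum>x\<leftarrow>map fst zs. x - k)"
    if "nilpotent_mat N C" "similar_mat C (jordan_matrix zs)" "\<forall>(n, a)\<in>set zs. a = 0" for C zs k c
  proof -
    have "C \<in> carrier_mat N N" using that(1) unfolding nilpotent_mat_def by blast
    then have "has_rank (C ^\<^sub>m k) c \<longleftrightarrow> has_rank (jordan_matrix zs ^\<^sub>m k) c"
      unfolding has_rank_def using rank_ge_pow_similar[OF that(2)] by simp
    moreover have "(\<Sum>(n, a)\<leftarrow>zs. n - k) = (\<Sum>x\<leftarrow>map fst zs. x - k)"
      by (simp add: comp_def case_prod_unfold)
    ultimately show ?thesis using has_rank_jordan_matrix_zero_pow[OF that(3), of k] has_rank_unique by metis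
  qed
  have "mset (map fst xs) = mset (map fst ys)"
  proof (rule mset_eq_of_truncated_sums)
    show "(\<Sum>x\<leftarrow>map fst xs. x - k) = (\<Sum>y\<leftarrow>map fst ys. y - k)" for k
      using ranks[of k] rank[OF A sim(1) xs(2)] rank[OF B sim(2) ys(2)] by metis
  qed (use xs(1) ys(1) in \<open>auto simp: jordan_nf_def\<close>)
  moreover have "zs = map (\<lambda>n. (n, 0)) (map fst zs)" if "\<forall>(n, a)\<in>set zs. a = 0"
    for zs :: "(nat \<times> complex) list"
    using that by (intro nth_equalityI) (auto simp: case_prod_unfold prod_eq_iff dest: nth_mem)
  ultimately have "mset xs = mset ys" using xs(2) ys(2) by (metis mset_map)
  then have "similar_mat (jordan_matrix xs) (jordan_matrix ys)" by (rule similar_jordan_matrix_mset)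
  then show ?thesis using sim similar_mat_trans similar_mat_sym by blast
qed

subsection \<open>Limits of matrices\<close>

text \<open>Determinants of products and powers of matrices are built from constants, sums and
  products of entries. This is stated once for two uses: convergent sequences and polynomials along
  a line.\<close>

locale fun_algebra =
  fixes F :: "('a \<Rightarrow> complex) set"
  assumes const [simp]: "(\<lambda>_. c) \<in> F"
    and add [intro]: "f \<in> F \<Longrightarrow> g \<in> F \<Longrightarrow> (\<lambda>x. f x + g x) \<in> F"
    and mult [intro]: "f \<in> F \<Longrightarrow> g \<in> F \<Longrightarrow> (\<lambda>x. f x * g x) \<in> F"
begin

lemma sum: "(\<And>i. i \<in> S \<Longrightarrow> f i \<in> F) \<Longrightarrow> (\<lambda>x. \<Sum>i\<in>S. f i x) \<in> F"
  by (induction S rule: infinite_finite_induct) (simp_all add: add)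

lemma prod: "(\<And>i. i \<in> S \<Longrightarrow> f i \<in> F) \<Longrightarrow> (\<lambda>x. \<Prod>i\<in>S. f i x) \<in> F"
  by (induction S rule: infinite_finite_induct) (simp_all add: mult)

definition mats :: "nat \<Rightarrow> nat \<Rightarrow> ('a \<Rightarrow> complex mat) set" where
  "mats r c = {A. \<forall>x. A x \<in> carrier_mat r c \<and> (\<forall>i<r. \<forall>j<c. (\<lambda>x. A x $$ (i, j)) \<in> F)}"

lemma mats_const: "M \<in> carrier_mat r c \<Longrightarrow> (\<lambda>_. M) \<in> mats r c"
  by (simp add: mats_def)

lemma mats_mult:
  assumes "A \<in> mats a b" "B \<in> mats b c"
  shows "(\<lambda>x. A x * B x) \<in> mats a c"
proof -
  have "(\<lambda>x. (A x * B x) $$ (i, j)) \<in> F" if "i < a" "j < c" for i j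
  proof -
    have "(\<lambda>x. (A x * B x) $$ (i, j)) = (\<lambda>x. \<Sum>s = 0..<b. A x $$ (i, s) * B x $$ (s, j))"
      using assms that by (intro ext index_mult_mat_sum) (auto simp: mats_def)
    also have "\<dots> \<in> F" using assms that by (intro sum mult) (auto simp: mats_def)
    finally show ?thesis .
  qed
  then show ?thesis using assms by (auto simp: mats_def intro: mult_carrier_mat)
qed

lemma mats_pow:
  assumes "A \<in> mats a a"
  shows "(\<lambda>x. A x ^\<^sub>m k) \<in> mats a a"
proof (induction k)
  case 0
  have "dim_row (A x) = a" for x using assms by (auto simp: mats_def)
  then show ?case using mats_const[of "1\<^sub>m a"] by simp
next
  case (Suc k)
  then show ?case using mats_mult[OF Suc assms] by simp
qed

lemma det_mats:
  assumes "A \<in> mats a a"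
  shows "(\<lambda>x. det (A x)) \<in> F"
proof -
  have "(\<lambda>x. det (A x)) =
      (\<lambda>x. \<Sum>p | p permutes {0..<a}. signof p * (\<Prod>i = 0..<a. A x $$ (i, p i)))"
    using assms by (intro ext det_def') (auto simp: mats_def)
  also have "\<dots> \<in> F"
  proof (intro sum mult const prod)
    fix p i assume "p \<in> {p. p permutes {0..<a}}" "i \<in> {0..<a}"
    then have "i < a" "p i < a" using permutes_in_image[of p "{0..<a}" i] by auto
    then show "(\<lambda>x. A x $$ (i, p i)) \<in> F" using assms by (simp add: mats_def)
  qed
  finally show ?thesis .
qed

lemma mats_index: "A \<in> mats r c \<Longrightarrow> i < r \<Longrightarrow> j < c \<Longrightarrow> (\<lambda>x. A x $$ (i, j)) \<in> F"
  by (simp add: mats_def)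

end

text \<open>
  A convergent sequence with its limit is encoded as a function on \<^typ>\<open>nat option\<close>, with the
  limit as the value at \<^term>\<open>None\<close>.
\<close>

definition convergent_funs :: "(nat option \<Rightarrow> complex) set" where
  "convergent_funs = {f. (\<lambda>m. f (Some m)) \<longlonglongrightarrow> f None}"

interpretation convs: fun_algebra convergent_funs
  by unfold_locales (auto simp: convergent_funs_def intro: tendsto_add tendsto_mult)

definition poly_funs :: "(complex \<Rightarrow> complex) set" where
  "poly_funs = range poly"

interpretation polys: fun_algebra poly_funs
proof
  show "(\<lambda>_. c) \<in> poly_funs" for c
    unfolding poly_funs_def by (rule range_eqI[of _ _ "[:c:]"]) auto
  fix f g assume "f \<in> poly_funs" "g \<in> poly_funs"
  then obtain p q where "f = poly p" "g = poly q" by (auto simp: poly_funs_def)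
  then have "(\<lambda>x. f x + g x) = poly (p + q)" "(\<lambda>x. f x * g x) = poly (p * q)" by auto
  then show "(\<lambda>x. f x + g x) \<in> poly_funs" "(\<lambda>x. f x * g x) \<in> poly_funs"
    unfolding poly_funs_def by simp_all
qed

lemma mats_case_option:
  assumes "X \<in> carrier_mat N M" "\<And>m. S m \<in> carrier_mat N M"
    and "\<And>i j. i < N \<Longrightarrow> j < M \<Longrightarrow> (\<lambda>m. S m $$ (i, j)) \<longlonglongrightarrow> X $$ (i, j)"
  shows "case_option X S \<in> convs.mats N M"
  unfolding convs.mats_def using assms by (auto simp: convergent_funs_def split: option.split)

lemma topspace_mat_topology: "topspace (mat_topology N) = carrier_mat N N"
  by (auto simp: mat_topology_def topspace_pullback_topology)

text \<open>There are finitely many entries, so entrywise convergence eventually enters every box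
  around the limit.\<close>

lemma closure_of_matI:
  assumes X: "X \<in> carrier_mat N N" and S: "\<And>m. S m \<in> C" "C \<subseteq> carrier_mat N N"
    and lim: "\<And>i j. i < N \<Longrightarrow> j < N \<Longrightarrow> (\<lambda>m. S m $$ (i, j)) \<longlonglongrightarrow> X $$ (i, j)"
  shows "X \<in> mat_topology N closure_of C"
proof (unfold in_closure_of, intro conjI allI impI)
  fix T assume T: "X \<in> T \<and> openin (mat_topology N) T"
  let ?I = "{..<N} \<times> {..<N}"
  obtain V where V: "openin (product_topology (\<lambda>_. euclidean) ?I) V"
    "T = (\<lambda>A. \<lambda>p\<in>?I. A $$ p) -` V \<inter> carrier_mat N N"
    using T unfolding mat_topology_def openin_pullback_topology by blast
  define x where "x = (\<lambda>p\<in>?I. X $$ p)"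
  have "x \<in> V" using T V(2) by (auto simp: x_def)
  moreover have "\<forall>x\<in>V. \<exists>U. finite {p \<in> ?I. U p \<noteq> UNIV} \<and>
      (\<forall>p\<in>?I. open (U p)) \<and> x \<in> Pi\<^sub>E ?I U \<and> Pi\<^sub>E ?I U \<subseteq> V"
    using V(1) by (simp only: openin_product_topology_alt topspace_euclidean open_openin[symmetric])
  ultimately obtain U where U: "\<forall>p\<in>?I. open (U p)" "x \<in> Pi\<^sub>E ?I U" "Pi\<^sub>E ?I U \<subseteq> V"
    by meson
  have "\<forall>p\<in>?I. \<forall>\<^sub>F m in sequentially. S m $$ p \<in> U p"
  proof
    fix p assume p: "p \<in> ?I"
    then obtain i j where ij: "p = (i, j)" "i < N" "j < N" by auto
    have "X $$ p \<in> U p" using PiE_mem[OF U(2) p] p by (simp add: x_def)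
    then show "\<forall>\<^sub>F m in sequentially. S m $$ p \<in> U p"
      using topological_tendstoD[OF lim[OF ij(2,3)]] U(1) p ij(1) by blast
  qed
  then have "\<forall>\<^sub>F m in sequentially. \<forall>p\<in>?I. S m $$ p \<in> U p"
    by (intro eventually_ball_finite) auto
  then obtain m where "\<forall>p\<in>?I. S m $$ p \<in> U p" using eventually_happens by force
  then have "(\<lambda>p\<in>?I. S m $$ p) \<in> V" using U(3) by (intro subsetD[OF U(3)]) auto
  then show "\<exists>Y. Y \<in> C \<and> Y \<in> T" using S by (intro exI[of _ "S m"]) (auto simp: V(2))
qed (use X in \<open>simp add: topspace_mat_topology\<close>)

text \<open>The open boxes of radius \<open>1 / (m + 1)\<close> around \<open>X\<close> all meet
  \<open>C\<close>, and choosing a point in each gives the sequence.\<close>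

lemma closure_of_matD:
  assumes "X \<in> mat_topology N closure_of C"
  obtains S where "\<And>m. S m \<in> C" "\<And>i j. i < N \<Longrightarrow> j < N \<Longrightarrow> (\<lambda>m. S m $$ (i, j)) \<longlonglongrightarrow> X $$ (i, j)"
    "X \<in> carrier_mat N N"
proof -
  let ?I = "{..<N} \<times> {..<N}"
  have X: "X \<in> carrier_mat N N"
    using assms unfolding in_closure_of topspace_mat_topology by blast
  have "\<exists>Y\<in>C. \<forall>i<N. \<forall>j<N. dist (Y $$ (i, j)) (X $$ (i, j)) < 1 / real (Suc m)" for m
  proof -
    define U where "U = (\<lambda>p. ball (X $$ p) (1 / real (Suc m)))"
    define T where "T = (\<lambda>A. \<lambda>p\<in>?I. A $$ p) -` Pi\<^sub>E ?I U \<inter> carrier_mat N N"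
    have "openin (product_topology (\<lambda>_. euclidean) ?I) (Pi\<^sub>E ?I U)"
      by (subst openin_PiE) (auto simp: U_def)
    then have "openin (mat_topology N) T"
      unfolding mat_topology_def openin_pullback_topology T_def by blast
    moreover have "X \<in> T" using X by (auto simp: T_def U_def)
    ultimately obtain Y where Y: "Y \<in> C" "Y \<in> T" using assms unfolding in_closure_of by blast
    have "dist (Y $$ (i, j)) (X $$ (i, j)) < 1 / real (Suc m)" if "i < N" "j < N" for i j
    proof -
      have "(i, j) \<in> ?I" using that by simp
      moreover have "(\<lambda>p\<in>?I. Y $$ p) \<in> Pi\<^sub>E ?I U" using Y(2) by (simp add: T_def)
      ultimately have "Y $$ (i, j) \<in> U (i, j)" by (metis PiE_mem restrict_apply')
      then show ?thesis by (simp add: U_def dist_commute)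
    qed
    then show ?thesis using Y(1) by blast
  qed
  then obtain S where S: "\<And>m. S m \<in> C"
    "\<And>m i j. i < N \<Longrightarrow> j < N \<Longrightarrow> dist (S m $$ (i, j)) (X $$ (i, j)) < 1 / real (Suc m)"
    by metis
  have "(\<lambda>m. S m $$ (i, j)) \<longlonglongrightarrow> X $$ (i, j)" if "i < N" "j < N" for i j
  proof (rule metric_LIMSEQ_I)
    fix e :: real assume "0 < e"
    then obtain k where k: "1 / real (Suc k) < e" using nat_approx_posE by blast
    have "dist (S m $$ (i, j)) (X $$ (i, j)) < e" if "m \<ge> k" for m
    proof -
      have "1 / real (Suc m) \<le> 1 / real (Suc k)" using that by (intro divide_left_mono) auto
      then show ?thesis using S(2)[OF \<open>i < N\<close> \<open>j < N\<close>, of m] k by simp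
    qed
    then show "\<exists>k. \<forall>m\<ge>k. dist (S m $$ (i, j)) (X $$ (i, j)) < e" by blast
  qed
  then show thesis using that S(1) X by blast
qed

text \<open>Lower semicontinuity of rank: the determinant is continuous in the entries, so a nonzero
  limit value is eventually nonzero along the sequence.\<close>

lemma det_closure_of_nonzero:
  assumes X: "X \<in> mat_topology N closure_of C" and C: "C \<subseteq> carrier_mat N N"
    and P: "P \<in> carrier_mat r N" and Q: "Q \<in> carrier_mat N r" and d: "det (P * X ^\<^sub>m k * Q) \<noteq> 0"
  shows "\<exists>Y\<in>C. det (P * Y ^\<^sub>m k * Q) \<noteq> 0"
proof -
  obtain S where S: "\<And>m. S m \<in> C" "\<And>i j. i < N \<Longrightarrow> j < N \<Longrightarrow> (\<lambda>m. S m $$ (i, j)) \<longlonglongrightarrow> X $$ (i, j)"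
    "X \<in> carrier_mat N N"
    using closure_of_matD[OF X] by blast
  have "case_option X S \<in> convs.mats N N"
    using S C by (intro mats_case_option) auto
  then have "(\<lambda>x. det (P * case_option X S x ^\<^sub>m k * Q)) \<in> convergent_funs"
    by (intro convs.det_mats[of _ r] convs.mats_mult[of _ r N] convs.mats_pow convs.mats_const P Q)
  then have "(\<lambda>m. det (P * S m ^\<^sub>m k * Q)) \<longlonglongrightarrow> det (P * X ^\<^sub>m k * Q)"
    by (simp add: convergent_funs_def)
  then have "\<forall>\<^sub>F m in sequentially. det (P * S m ^\<^sub>m k * Q) \<noteq> 0"
    using d by (rule tendsto_imp_eventually_ne)
  then obtain m where "det (P * S m ^\<^sub>m k * Q) \<noteq> 0" using eventually_happens by force
  then show ?thesis using S(1) by blast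
qed

subsection \<open>Saturations of ideals are closed\<close>

text \<open>The columns of \<open>u\<close> are chosen from last to first: column \<open>p\<close>
  is a unit vector orthogonal to the columns \<open>s < p\<close> of \<open>g\<close> and to the
  columns of \<open>u\<close> already chosen. The first condition makes the product
  triangular.\<close>

lemma exists_unitary_triangular:
  assumes g: "g \<in> carrier_mat N N"
  shows "\<exists>u\<in>carrier_mat N N. mat N N (\<lambda>(i, j). cnj (u $$ (j, i))) * u = 1\<^sub>m N \<and>
    upper_triangular (mat N N (\<lambda>(i, j). cnj (u $$ (j, i))) * g)"
proof -
  define ip where "ip x y = (\<Sum>i = 0..<N. cnj (x i) * y i)" for x y :: "nat \<Rightarrow> complex"
  define col where "col s = (\<lambda>i. g $$ (i, s))" for s
  have ip_swap: "ip y x = cnj (ip x y)" for x y by (simp add: ip_def mult.commute)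
  have "\<exists>u. \<forall>p\<in>{N - k..<N}. ip (u p) (u p) = 1 \<and> (\<forall>s<p. ip (u p) (col s) = 0) \<and>
      (\<forall>r\<in>{N - k..<N} - {p}. ip (u p) (u r) = 0)" if "k \<le> N" for k
    using that
  proof (induction k)
    case (Suc k)
    then obtain u where u: "\<forall>p\<in>{N - k..<N}. ip (u p) (u p) = 1 \<and> (\<forall>s<p. ip (u p) (col s) = 0) \<and>
      (\<forall>r\<in>{N - k..<N} - {p}. ip (u p) (u r) = 0)" by auto
    define q where "q = N - Suc k"
    have q: "q < N" "N - k = Suc q" using Suc.prems by (auto simp: q_def)
    \<comment> \<open>The \<open>N - 1\<close> vectors to which the new one must be orthogonal,
      padded by zero at index \<open>q\<close>. The zero row makes \<open>M\<close> singular, and a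
      kernel vector is the one sought up to scaling.\<close>
    define w where "w s = (if s < q then col s else if s = q then (\<lambda>_. 0) else u s)" for s
    define M where "M = mat N N (\<lambda>(s, i). cnj (w s i))"
    have M: "M \<in> carrier_mat N N" by (simp add: M_def)
    have "det M = (\<Sum>j<N. M $$ (q, j) * cofactor M q j)" by (rule laplace_expansion_row[OF M q(1)])
    also have "\<dots> = 0" using q by (intro sum.neutral) (auto simp: M_def w_def)
    finally have "det M = 0" .
    then obtain v where v: "v \<in> carrier_vec N" "v \<noteq> 0\<^sub>v N" "M *\<^sub>v v = 0\<^sub>v N"
      using det_0_iff_vec_prod_zero[OF M] by blast
    have "ip (w s) (\<lambda>i. v $ i) = (M *\<^sub>v v) $ s" if "s < N" for s
      using that v(1) by (simp add: ip_def M_def scalar_prod_def)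
    then have orth: "ip (w s) (\<lambda>i. v $ i) = 0" if "s < N" for s using that v(3) by simp
    define c where "c = (\<Sum>i = 0..<N. (cmod (v $ i))\<^sup>2)"
    obtain i where "i < N" "v $ i \<noteq> 0" using v(1,2) by (metis carrier_vecD eq_vecI index_zero_vec)
    then have "c > 0" unfolding c_def by (intro sum_pos2[of _ i]) auto
    define x where "x = (\<lambda>i. v $ i / complex_of_real (sqrt c))"
    have "ip x x = (\<Sum>i = 0..<N. complex_of_real ((cmod (v $ i))\<^sup>2) / complex_of_real c)"
      unfolding ip_def x_def
    proof (rule sum.cong)
      fix i
      have "complex_of_real (sqrt c) * complex_of_real (sqrt c) = complex_of_real c"
        using \<open>c > 0\<close> by (simp flip: of_real_mult)
      moreover have "cnj (v $ i) * v $ i = complex_of_real ((cmod (v $ i))\<^sup>2)"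
        unfolding complex_norm_square by (rule mult.commute)
      ultimately show "cnj (v $ i / complex_of_real (sqrt c)) * (v $ i / complex_of_real (sqrt c)) =
        complex_of_real ((cmod (v $ i))\<^sup>2) / complex_of_real c"
        by simp
    qed simp
    also have "\<dots> = complex_of_real c / complex_of_real c"
      unfolding sum_divide_distrib[symmetric] of_real_sum[symmetric] c_def ..
    finally have xx: "ip x x = 1" using \<open>c > 0\<close> by simp
    have wx: "ip (w s) x = 0" if "s < N" for s
    proof -
      have "ip (w s) x = ip (w s) (\<lambda>i. v $ i) / complex_of_real (sqrt c)"
        by (simp add: ip_def x_def sum_divide_distrib)
      then show ?thesis using orth[OF that] by simp
    qed
    have colx: "ip x (col s) = 0" if "s < q" for s
      using wx[of s] that q ip_swap[of x "col s"] by (simp add: w_def)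
    have ux: "ip (u r) x = 0" "ip x (u r) = 0" if "r \<in> {Suc q..<N}" for r
      using wx[of r] that ip_swap[of x "u r"] by (auto simp: w_def)
    have "{N - Suc k..<N} = insert q {Suc q..<N}" using q by (auto simp: q_def)
    then show ?case
      using u xx colx ux q by (intro exI[of _ "u(q := x)"]) auto
  qed auto
  from this[of N] obtain u where "\<forall>p\<in>{0..<N}. ip (u p) (u p) = 1 \<and> (\<forall>s<p. ip (u p) (col s) = 0) \<and>
      (\<forall>r\<in>{0..<N} - {p}. ip (u p) (u r) = 0)" by auto
  then have u: "ip (u p) (u p) = 1" "s < p \<Longrightarrow> ip (u p) (col s) = 0"
    "r < N \<Longrightarrow> r \<noteq> p \<Longrightarrow> ip (u p) (u r) = 0" if "p < N" for p r s
    using that by auto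
  define U where "U = mat N N (\<lambda>(i, j). u j i)"
  define V where "V = mat N N (\<lambda>(i, j). cnj (U $$ (j, i)))"
  have U: "U \<in> carrier_mat N N" and V: "V \<in> carrier_mat N N" by (simp_all add: U_def V_def)
  have "(V * U) $$ (i, j) = ip (u i) (u j)" if "i < N" "j < N" for i j
    unfolding index_mult_mat_sum[OF V U that] ip_def
    using that by (intro sum.cong) (auto simp: U_def V_def)
  then have "V * U = 1\<^sub>m N"
    using u U V by (intro eq_matI) (auto simp del: index_mult_mat(1))
  moreover have "(V * g) $$ (i, j) = ip (u i) (col j)" if "i < N" "j < N" for i j
    unfolding index_mult_mat_sum[OF V g that] ip_def
    using that by (intro sum.cong) (auto simp: U_def V_def col_def)
  then have "upper_triangular (V * g)"
    using u(2) V by (auto simp: upper_triangular_def simp del: index_mult_mat(1))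
  ultimately show ?thesis using U V_def by blast
qed

text \<open>Subsequences are extracted for one index at a time; earlier convergence survives further
  extraction.\<close>

lemma bounded_imp_common_convergent_subsequence:
  fixes a :: "'s \<Rightarrow> nat \<Rightarrow> complex"
  assumes "finite S" "\<And>s. s \<in> S \<Longrightarrow> bounded (range (a s))"
  shows "\<exists>r. strict_mono r \<and> (\<forall>s\<in>S. convergent (\<lambda>m. a s (r m)))"
  using assms
proof (induction S rule: finite_induct)
  case empty
  show ?case by (intro exI[of _ "\<lambda>m. m"]) (auto simp: strict_mono_def)
next
  case (insert s S)
  then obtain r where r: "strict_mono r" "\<forall>s\<in>S. convergent (\<lambda>m. a s (r m))" by blast
  have "bounded (range (a s \<circ> r))"
    using insert.prems[of s] by (auto intro: bounded_subset simp: image_comp[symmetric])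
  then obtain l q where q: "strict_mono q" "((a s \<circ> r) \<circ> q) \<longlonglongrightarrow> l"
    using bounded_imp_convergent_subsequence[of "a s \<circ> r"] by metis
  have "convergent (\<lambda>m. a t (r (q m)))" if "t \<in> insert s S" for t
  proof (cases "t = s")
    case True
    then show ?thesis using q(2) by (auto simp: convergent_def comp_def)
  next
    case False
    then have "convergent (\<lambda>m. a t (r m))" using r(2) that by blast
    then show ?thesis using convergent_subseq_convergent[OF _ q(1)] by (fastforce simp: comp_def)
  qed
  then show ?case
    using strict_mono_o[OF r(1) q(1)] by (intro exI[of _ "r \<circ> q"]) (simp add: comp_def)
qed

lemma similar_mat_carrier:
  assumes "similar_mat A B" "B \<in> carrier_mat N N"
  shows "A \<in> carrier_mat N N"
proof -
  obtain M where "{A, B} \<subseteq> carrier_mat M M" using similar_matD[OF assms(1)] by auto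
  then show ?thesis using assms(2) by auto
qed

lemma conj_saturation_subset_carrier:
  assumes "S \<subseteq> carrier_mat N N"
  shows "conj_saturation S \<subseteq> carrier_mat N N"
  using assms similar_mat_carrier unfolding conj_saturation_def by blast

lemma mult_inverse_cancel:
  fixes A B Z :: "'a :: comm_ring_1 mat"
  assumes "A \<in> carrier_mat N N" "B \<in> carrier_mat N N" "Z \<in> carrier_mat N N" "A * B = 1\<^sub>m N"
  shows "A * (B * Z) = Z"
  using assoc_mult_mat[OF assms(1-3)] assms(3,4) by simp

lemma conj_saturation_closed:
  assumes I: "ad_nilpotent_ideal n I"
  shows "mat_topology (n + 1) closure_of conj_saturation I \<subseteq> conj_saturation I"
proof
  let ?N = "n + 1"
  obtain R where R: "I = root_space_sum n R" using ideal_is_root_space_sum[OF I] by blast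
  fix Y assume "Y \<in> mat_topology ?N closure_of conj_saturation I"
  then obtain S where S: "\<And>m. S m \<in> conj_saturation I"
    "\<And>i j. i < ?N \<Longrightarrow> j < ?N \<Longrightarrow> (\<lambda>m. S m $$ (i, j)) \<longlonglongrightarrow> Y $$ (i, j)" "Y \<in> carrier_mat ?N ?N"
    using closure_of_matD by blast
  define adj where "adj u = mat ?N ?N (\<lambda>(i, j). cnj (u $$ (j, i)))" for u :: "complex mat"
  \<comment> \<open>With \<open>S m = g * X * h\<close> and \<open>adj u * g\<close> upper
    triangular, conjugating \<open>S m\<close> by the unitary \<open>u\<close> amounts to
    conjugating \<open>X\<close> by a triangular matrix, which stays in \<open>I\<close>.\<close>
  have "\<exists>u\<in>carrier_mat ?N ?N. adj u * u = 1\<^sub>m ?N \<and> adj u * S m * u \<in> I \<and> S m \<in> carrier_mat ?N ?N" for m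
  proof -
    obtain X where X: "X \<in> I" "similar_mat (S m) X" using S(1) unfolding conj_saturation_def by blast
    note Xc = ideal_carrier[OF I X(1)]
    have Sc: "S m \<in> carrier_mat ?N ?N" by (rule similar_mat_carrier[OF X(2) Xc])
    obtain g h where w: "similar_mat_wit (S m) X g h" using X(2) unfolding similar_mat_def by blast
    note gh = similar_mat_witD2[OF Sc w]
    obtain u where u: "u \<in> carrier_mat ?N ?N" "adj u * u = 1\<^sub>m ?N" "upper_triangular (adj u * g)"
      using exists_unitary_triangular[OF gh(6)] unfolding adj_def by blast
    have a: "adj u \<in> carrier_mat ?N ?N" by (simp add: adj_def)
    have u': "u * adj u = 1\<^sub>m ?N" by (rule mat_mult_left_right_inverse[OF a u(1,2)])
    note assoc = assoc_mult_mat[of _ ?N ?N _ ?N _ ?N]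
    note cancel = mult_inverse_cancel[OF u(1) a _ u'] mult_inverse_cancel[OF a u(1) _ u(2)]
      mult_inverse_cancel[OF gh(6,7) _ gh(1)] mult_inverse_cancel[OF gh(7,6) _ gh(2)]
    have "similar_mat_wit (adj u * S m * u) X (adj u * g) (h * u)"
    proof (rule similar_mat_witI)
      show "adj u * S m * u = adj u * g * X * (h * u)"
        using u a gh by (simp add: assoc)
      show "adj u * g * (h * u) = 1\<^sub>m ?N" "h * u * (adj u * g) = 1\<^sub>m ?N"
        using u a u' gh cancel by (simp_all add: assoc)
    qed (use u a gh in auto)
    then have "adj u * S m * u \<in> I" using ideal_conj[OF I X(1) u(3)] by blast
    then show ?thesis using u Sc by blast
  qed
  then obtain U where U: "\<And>m. U m \<in> carrier_mat ?N ?N" "\<And>m. adj (U m) * U m = 1\<^sub>m ?N"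
    "\<And>m. adj (U m) * S m * U m \<in> I" and Sc: "\<And>m. S m \<in> carrier_mat ?N ?N"
    by metis
  have adjc: "adj u \<in> carrier_mat ?N ?N" for u by (simp add: adj_def)
  \<comment> \<open>Columns of a unitary matrix have norm 1; the entries are bounded and a common
    subsequence converges.\<close>
  have "cmod (U m $$ (i, j)) \<le> 1" if ij: "i < ?N" "j < ?N" for m i j
  proof -
    have "(\<Sum>s = 0..<?N. adj (U m) $$ (j, s) * U m $$ (s, j)) = (adj (U m) * U m) $$ (j, j)"
      by (rule index_mult_mat_sum[symmetric]) (use U adjc ij in auto)
    also have "\<dots> = 1" using U(2) ij by simp
    also have "(\<Sum>s = 0..<?N. adj (U m) $$ (j, s) * U m $$ (s, j)) =
        complex_of_real (\<Sum>s = 0..<?N. (cmod (U m $$ (s, j)))\<^sup>2)"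
      unfolding of_real_sum
      unfolding complex_norm_square using ij by (intro sum.cong) (auto simp: adj_def)
    finally have "(\<Sum>s = 0..<?N. (cmod (U m $$ (s, j)))\<^sup>2) = 1" by (simp only: of_real_eq_1_iff)
    moreover have "(cmod (U m $$ (i, j)))\<^sup>2 \<le> (\<Sum>s = 0..<?N. (cmod (U m $$ (s, j)))\<^sup>2)"
      by (rule member_le_sum) (use ij in auto)
    ultimately show ?thesis by (simp add: power_le_one_iff abs_square_le_1)
  qed
  then have "bounded (range (\<lambda>m. U m $$ p))" if "p \<in> {..<?N} \<times> {..<?N}" for p
    using that unfolding bounded_iff by fastforce
  then obtain r where r: "strict_mono r"
    "\<forall>p\<in>{..<?N} \<times> {..<?N}. convergent (\<lambda>m. U (r m) $$ p)"
    using bounded_imp_common_convergent_subsequence[of "{..<?N} \<times> {..<?N}" "\<lambda>p m. U m $$ p"] by auto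
  define u where "u = mat ?N ?N (\<lambda>p. lim (\<lambda>m. U (r m) $$ p))"
  have uc: "u \<in> carrier_mat ?N ?N" by (simp add: u_def)
  have lim: "(\<lambda>m. U (r m) $$ (i, j)) \<longlonglongrightarrow> u $$ (i, j)" if "i < ?N" "j < ?N" for i j
    using r(2) that by (simp add: u_def convergent_LIMSEQ_iff)
  have mU: "case_option u (\<lambda>m. U (r m)) \<in> convs.mats ?N ?N"
    by (rule mats_case_option) (use uc U lim in auto)
  have "case_option (adj u) (\<lambda>m. adj (U (r m))) \<in> convs.mats ?N ?N"
    by (rule mats_case_option) (use adjc lim in \<open>auto simp: adj_def intro: tendsto_cnj\<close>)
  then have mA: "(\<lambda>x. adj (case_option u (\<lambda>m. U (r m)) x)) \<in> convs.mats ?N ?N"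
    by (rule back_subst[of "\<lambda>f. f \<in> convs.mats ?N ?N"]) (auto split: option.split)
  have mS: "case_option Y (\<lambda>m. S (r m)) \<in> convs.mats ?N ?N"
  proof (rule mats_case_option)
    show "(\<lambda>m. S (r m) $$ (i, j)) \<longlonglongrightarrow> Y $$ (i, j)" if "i < ?N" "j < ?N" for i j
      using LIMSEQ_subseq_LIMSEQ[OF S(2)[OF that] r(1)] by (simp add: comp_def)
  qed (use S Sc in auto)
  have one: "adj u * u = 1\<^sub>m ?N"
  proof (rule eq_matI)
    fix i j assume "i < dim_row (1\<^sub>m ?N :: complex mat)" "j < dim_col (1\<^sub>m ?N :: complex mat)"
    then have ij: "i < ?N" "j < ?N" by auto
    have "(\<lambda>m. (adj (U (r m)) * U (r m)) $$ (i, j)) \<longlonglongrightarrow> (adj u * u) $$ (i, j)"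
      using convs.mats_index[OF convs.mats_mult[OF mA mU] ij] by (simp add: convergent_funs_def del: index_mult_mat(1))
    then show "(adj u * u) $$ (i, j) = 1\<^sub>m ?N $$ (i, j)"
      unfolding U(2) by (simp add: LIMSEQ_const_iff del: index_mult_mat(1))
  qed (use adjc uc in auto)
  have one': "u * adj u = 1\<^sub>m ?N" by (rule mat_mult_left_right_inverse[OF adjc uc one])
  let ?X = "adj u * Y * u"
  \<comment> \<open>The ideal is cut out by the vanishing of entries, a condition preserved in the
    limit.\<close>
  have "?X \<in> I"
  proof -
    have "(i + 1, j) \<in> R" if ij: "i < ?N" "j < ?N" and ne: "?X $$ (i, j) \<noteq> 0" for i j
    proof -
      have "(\<lambda>m. (adj (U (r m)) * S (r m) * U (r m)) $$ (i, j)) \<longlonglongrightarrow> ?X $$ (i, j)"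
        using convs.mats_index[OF convs.mats_mult[OF convs.mats_mult[OF mA mS] mU] ij]
        by (simp add: convergent_funs_def del: index_mult_mat(1))
      then have "\<forall>\<^sub>F m in sequentially. (adj (U (r m)) * S (r m) * U (r m)) $$ (i, j) \<noteq> 0"
        using ne by (rule tendsto_imp_eventually_ne)
      then obtain m where "(adj (U (r m)) * S (r m) * U (r m)) $$ (i, j) \<noteq> 0"
        using eventually_happens by force
      then show ?thesis using U(3)[of "r m"] ij unfolding R root_space_sum_def by blast
    qed
    moreover have "?X \<in> carrier_mat ?N ?N" using adjc[of u] uc S(3) by simp
    ultimately show ?thesis unfolding R root_space_sum_def by blast
  qed
  moreover have "similar_mat Y ?X"
  proof (rule similar_matI[of _ _ u "adj u" ?N])
    note assoc = assoc_mult_mat[of _ ?N ?N _ ?N _ ?N]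
    show "Y = u * ?X * adj u"
      using adjc[of u] uc S(3) one' mult_inverse_cancel[OF uc adjc[of u] _ one'] by (simp add: assoc)
  qed (use one one' adjc[of u] uc S(3) in auto)
  ultimately show "Y \<in> conj_saturation I" unfolding conj_saturation_def by blast
qed

subsection \<open>Nilradicals with weakly decreasing block sizes\<close>

text \<open>
  The sequence \<open>b\<close> lists the block boundaries \<open>0 = b\<^sub>0 < b\<^sub>1 < \<dots> < b\<^sub>l = N = b\<^bsub>l+1\<^esub> = \<dots>\<close>; concavity
  says that the block sizes \<open>b\<^bsub>i+1\<^esub> - b\<^sub>i\<close> are weakly decreasing.
\<close>

locale block_bounds =
  fixes N :: nat and b :: "nat \<Rightarrow> nat"
  assumes b_0: "b 0 = 0"
    and b_Suc: "b i \<le> b (Suc i)"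
    and concave: "b (Suc (Suc i)) + b i \<le> 2 * b (Suc i)"
    and b_le: "b i \<le> N"
    and b_top: "\<exists>i. b i = N"

text \<open>With positions counted from 0, \<open>(p, q)\<close> lies above the diagonal blocks
  exactly if some block boundary satisfies \<open>p < b i \<le> q\<close>.\<close>

definition nilradical :: "nat \<Rightarrow> (nat \<Rightarrow> nat) \<Rightarrow> complex mat set" where
  "nilradical N b = {X \<in> carrier_mat N N.
     \<forall>p<N. \<forall>q<N. X $$ (p, q) \<noteq> 0 \<longrightarrow> (\<exists>i. p < b i \<and> b i \<le> q)}"

lemma nilradical_carrier: "X \<in> nilradical N b \<Longrightarrow> X \<in> carrier_mat N N"
  by (simp add: nilradical_def)

context block_bounds
begin

lemma b_mono: "i \<le> j \<Longrightarrow> b i \<le> b j"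
  using lift_Suc_mono_le[of b i j] b_Suc by blast

lemma size_antimono: "i \<le> j \<Longrightarrow> b (Suc j) - b j \<le> b (Suc i) - b i"
proof (induction j rule: dec_induct)
  case (step j)
  then show ?case using concave[of j] b_Suc[of j] b_Suc[of "Suc j"] by linarith
qed simp

text \<open>Nonzero entries of \<open>Y\<close> lie in rows of a strictly earlier block than their
  column, so each further factor makes one more block of columns vanish.\<close>

lemma nilradical_pow_zero:
  assumes Y: "Y \<in> nilradical N b" and ij: "i < N" "j < b k"
  shows "(Y ^\<^sub>m k) $$ (i, j) = 0"
  using ij
proof (induction k arbitrary: i j)
  case 0
  then show ?case by (simp add: b_0)
next
  case (Suc k)
  note Yc = nilradical_carrier[OF Y]
  have j: "j < N" using Suc.prems b_le[of "Suc k"] by simp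
  have "(Y ^\<^sub>m Suc k) $$ (i, j) = (Y ^\<^sub>m k * Y) $$ (i, j)" by simp
  also have "\<dots> = (\<Sum>s = 0..<N. (Y ^\<^sub>m k) $$ (i, s) * Y $$ (s, j))"
    by (rule index_mult_mat_sum[of _ N N _ N]) (use Yc Suc.prems j in auto)
  also have "\<dots> = 0"
  proof (rule sum.neutral, rule ballI)
    fix s assume s: "s \<in> {0..<N}"
    show "(Y ^\<^sub>m k) $$ (i, s) * Y $$ (s, j) = 0"
    proof (cases "Y $$ (s, j) = 0")
      case False
      then obtain l where l: "s < b l" "b l \<le> j" using Y s j by (auto simp: nilradical_def)
      have "l \<le> k"
      proof (rule ccontr)
        assume "\<not> l \<le> k"
        then have "b (Suc k) \<le> b l" by (intro b_mono) simp
        then show False using l Suc.prems by simp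
      qed
      then have "s < b k" using l b_mono[of l k] by simp
      then show ?thesis using Suc.IH[of i s] Suc.prems by simp
    qed simp
  qed
  finally show ?case .
qed

lemma nilradical_rank_le:
  assumes Y: "Y \<in> nilradical N b" and rk: "rank_ge r (Y ^\<^sub>m k)"
  shows "r \<le> N - b k"
proof -
  have "r \<le> card {b k..<N}"
    by (rule rank_ge_le_card[of "Y ^\<^sub>m k" N N])
      (use nilradical_carrier[OF Y] nilradical_pow_zero[OF Y] rk in auto)
  then show ?thesis by simp
qed

lemma nilradical_nilpotent:
  assumes Y: "Y \<in> nilradical N b"
  shows "nilpotent_mat N Y"
proof -
  obtain k where "b k = N" using b_top by blast
  then have "Y ^\<^sub>m k = 0\<^sub>m N N"
    using nilradical_pow_zero[OF Y, of _ _ k] nilradical_carrier[OF Y] by (intro eq_matI) auto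
  then show ?thesis using nilradical_carrier[OF Y] by (auto simp: nilpotent_mat_def)
qed

section \<open>An element of the nilradical whose powers have maximal rank\<close>

definition block_of :: "nat \<Rightarrow> nat" where
  "block_of q = (LEAST i. q < b (Suc i))"

lemma
  assumes "q < N"
  shows less_block_end: "q < b (Suc (block_of q))"
    and block_start_le: "b (block_of q) \<le> q"
proof -
  obtain i where "b i = N" using b_top by blast
  then have ex: "q < b (Suc i)" using assms b_Suc[of i] by simp
  show "q < b (Suc (block_of q))" unfolding block_of_def by (rule LeastI[of _ i]) (rule ex)
  show "b (block_of q) \<le> q"
  proof (cases "block_of q")
    case (Suc j)
    then have "\<not> q < b (Suc j)" unfolding block_of_def using not_less_Least[of j] by (metis lessI)
    then show ?thesis using Suc by simp
  qed (simp add: b_0)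
qed

lemma le_block_of_iff:
  assumes "q < N"
  shows "k \<le> block_of q \<longleftrightarrow> b k \<le> q"
proof
  assume "k \<le> block_of q"
  then show "b k \<le> q" using b_mono block_start_le[OF assms] le_trans by blast
next
  assume k: "b k \<le> q"
  show "k \<le> block_of q"
  proof (rule ccontr)
    assume "\<not> k \<le> block_of q"
    then have "b (Suc (block_of q)) \<le> b k" by (intro b_mono) simp
    then show False using k less_block_end[OF assms] by simp
  qed
qed

lemma block_of_eqI:
  assumes "b i \<le> q" "q < b (Suc i)"
  shows "block_of q = i"
proof -
  have "q < N" using assms b_le[of "Suc i"] by simp
  then show ?thesis using assms le_block_of_iff[of q i] le_block_of_iff[of q "Suc i"] by simp
qed

text \<open>The position with the same offset in the block \<open>k\<close> places earlier. It fits
  there because earlier blocks are at least as large; it is meaningful for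
  \<open>k \<le> block_of q\<close>, where the subtraction is exact.\<close>

definition shift :: "nat \<Rightarrow> nat \<Rightarrow> nat" where
  "shift k q = b (block_of q - k) + (q - b (block_of q))"

lemma
  assumes q: "q < N" "k \<le> block_of q"
  shows block_of_shift: "block_of (shift k q) = block_of q - k"
    and shift_offset: "shift k q - b (block_of q - k) = q - b (block_of q)"
    and shift_le: "shift k q \<le> q"
proof -
  have "q - b (block_of q) < b (Suc (block_of q)) - b (block_of q)"
    using less_block_end[OF q(1)] block_start_le[OF q(1)] by linarith
  also have "\<dots> \<le> b (Suc (block_of q - k)) - b (block_of q - k)"
    by (rule size_antimono) simp
  finally show "block_of (shift k q) = block_of q - k"
    by (intro block_of_eqI) (auto simp: shift_def)
  show "shift k q \<le> q"
    using b_mono[of "block_of q - k" "block_of q"] block_start_le[OF q(1)] by (simp add: shift_def)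
qed (simp add: shift_def)

lemma shift_shift:
  assumes "q < N" "Suc k \<le> block_of q"
  shows "shift k (shift 1 q) = shift (Suc k) q"
  using block_of_shift[of q 1] shift_offset[of q 1] assms
  by (simp add: shift_def[of k] shift_def[of "Suc k"])

lemma shift_inj: "inj_on (shift k) {q. q < N \<and> k \<le> block_of q}"
proof (rule inj_onI)
  fix p q assume p: "p \<in> {q. q < N \<and> k \<le> block_of q}" and q: "q \<in> {q. q < N \<and> k \<le> block_of q}"
    and eq: "shift k p = shift k q"
  have "block_of p - k = block_of q - k" using block_of_shift[of p k] block_of_shift[of q k] p q eq by simp
  then have "block_of p = block_of q" using p q by auto
  then have "p - b (block_of q) = q - b (block_of q)"
    using shift_offset[of p k] shift_offset[of q k] p q eq by simp
  then show "p = q" using block_start_le[of p] block_start_le[of q] p q \<open>block_of p = block_of q\<close> by simp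
qed

text \<open>The basis vector of each position is sent to that of the same offset in the preceding
  block, and the first block to zero. The \<open>k\<close>-th power has rank \<open>N - b k\<close>,
  the largest possible on the nilradical.\<close>

definition shift_mat :: "complex mat" where
  "shift_mat = mat N N (\<lambda>(p, q). if 1 \<le> block_of q \<and> p = shift 1 q then 1 else 0)"

lemma shift_mat_carrier [simp]: "shift_mat \<in> carrier_mat N N"
  by (simp add: shift_mat_def)

lemma shift_mat_pow:
  "shift_mat ^\<^sub>m k = mat N N (\<lambda>(p, q). if k \<le> block_of q \<and> p = shift k q then 1 else 0)"
proof (induction k)
  case 0
  have "dim_row shift_mat = N" by (simp add: shift_mat_def)
  then show ?case using block_start_le by (intro eq_matI) (auto simp: shift_def)
next
  case (Suc k)
  let ?M = "\<lambda>k. mat N N (\<lambda>(p, q). if k \<le> block_of q \<and> p = shift k q then 1 else 0 :: complex)"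
  have "shift_mat ^\<^sub>m Suc k = ?M k * shift_mat" using Suc by simp
  also have "\<dots> = ?M (Suc k)"
  proof (rule eq_matI)
    fix p q assume "p < dim_row (?M (Suc k))" "q < dim_col (?M (Suc k))"
    then have pq: "p < N" "q < N" by auto
    have "(?M k * shift_mat) $$ (p, q) = (\<Sum>s = 0..<N. ?M k $$ (p, s) * shift_mat $$ (s, q))"
      by (rule index_mult_mat_sum[of _ N N _ N]) (use pq in auto)
    also have "\<dots> = (\<Sum>s = 0..<N. if s = shift 1 q then (if 1 \<le> block_of q then ?M k $$ (p, s) else 0) else 0)"
      using pq by (intro sum.cong) (auto simp: shift_mat_def)
    also have "\<dots> = ?M (Suc k) $$ (p, q)"
    proof (cases "1 \<le> block_of q")
      case True
      then have "shift 1 q < N" using shift_le[of q 1] pq by simp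
      moreover have "block_of (shift 1 q) = block_of q - 1" using block_of_shift[of q 1] True pq by simp
      moreover have "k \<le> block_of q - 1 \<longleftrightarrow> Suc k \<le> block_of q" using True by linarith
      ultimately show ?thesis using True pq shift_shift[of q k] by auto
    next
      case False
      then show ?thesis using pq by (auto intro!: sum.neutral)
    qed
    finally show "(?M k * shift_mat) $$ (p, q) = ?M (Suc k) $$ (p, q)" .
  qed (auto simp: shift_mat_def)
  finally show ?case .
qed

lemma shift_mat_nilradical: "shift_mat \<in> nilradical N b"
proof -
  have "\<exists>i. p < b i \<and> b i \<le> q" if "p < N" "q < N" "1 \<le> block_of q" "p = shift 1 q" for p q
  proof -
    have "block_of p = block_of q - 1" using block_of_shift[of q 1] that by simp
    then have "p < b (block_of q)" using less_block_end[of p] that by simp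
    then show ?thesis using block_start_le[of q] that by blast
  qed
  then show ?thesis by (auto simp: nilradical_def shift_mat_def split: if_splits)
qed

lemma shift_mat_rank: "rank_ge (N - b k) (shift_mat ^\<^sub>m k)"
proof -
  have D: "{b k..<N} = {q. q < N \<and> k \<le> block_of q}" using le_block_of_iff by auto
  have "rank_ge (card {b k..<N}) (shift_mat ^\<^sub>m k)"
    unfolding D
  proof (rule rank_ge_partial_permutation[OF _ _ _ shift_inj])
    show "shift k q < N" if "q \<in> {q. q < N \<and> k \<le> block_of q}" for q
      using shift_le[of q k] that by simp
  qed (auto simp: shift_mat_pow)
  then show ?thesis by simp
qed

text \<open>The nilradical bounds the ranks from above and the assumption from below, so all powers
  have the same ranks as those of \<open>shift_mat\<close>.\<close>

lemma similar_shift_mat: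
  assumes Y: "nilpotent_mat N Y" "similar_mat Y Y0" "Y0 \<in> nilradical N b"
    and rk: "\<And>k. rank_ge (N - b k) (Y ^\<^sub>m k)"
  shows "similar_mat Y shift_mat"
proof (rule nilpotent_similar_of_ranks[OF Y(1) nilradical_nilpotent[OF shift_mat_nilradical]])
  fix k
  have "Y \<in> carrier_mat N N" using Y(1) by (simp add: nilpotent_mat_def)
  then have "has_rank (Y ^\<^sub>m k) (N - b k)"
    using rk nilradical_rank_le[OF Y(3)] rank_ge_pow_similar[OF Y(2)] by (simp add: has_rank_def)
  moreover have "has_rank (shift_mat ^\<^sub>m k) (N - b k)"
    using shift_mat_rank nilradical_rank_le[OF shift_mat_nilradical] by (simp add: has_rank_def)
  ultimately show "\<exists>c. has_rank (Y ^\<^sub>m k) c \<and> has_rank (shift_mat ^\<^sub>m k) c" by blast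
qed

section \<open>Density of the conjugates of \<open>shift_mat\<close>\<close>

lemma rank_ge_0: "A \<in> carrier_mat N N \<Longrightarrow> rank_ge 0 A"
  by (rule rank_geI[of _ N N "0\<^sub>m 0 N" _ "0\<^sub>m N 0"]) (auto simp: det_dim_zero)

text \<open>
  On the line through \<open>shift_mat\<close> and \<open>Y\<close>, the ranks of all powers are maximal outside finitely
  many points, since the relevant minors are polynomials on the line.
\<close>

lemma nilradical_dense:
  assumes Y: "Y \<in> nilradical N b"
  shows "\<exists>S. (\<forall>m. S m \<in> carrier_mat N N \<and> similar_mat (S m) shift_mat) \<and>
    (\<forall>i<N. \<forall>j<N. (\<lambda>m. S m $$ (i, j)) \<longlonglongrightarrow> Y $$ (i, j))"
proof -
  note Yc = nilradical_carrier[OF Y] and Xc = shift_mat_carrier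
  obtain K where K: "b K = N" using b_top by blast
  have "\<forall>k. \<exists>P Q. P \<in> carrier_mat (N - b k) N \<and> Q \<in> carrier_mat N (N - b k) \<and>
      det (P * shift_mat ^\<^sub>m k * Q) \<noteq> 0"
    using shift_mat_rank unfolding rank_ge_def
    by (metis Xc carrier_matD pow_carrier_mat)
  then obtain P Q where PQ: "\<And>k. P k \<in> carrier_mat (N - b k) N" "\<And>k. Q k \<in> carrier_mat N (N - b k)"
    "\<And>k. det (P k * shift_mat ^\<^sub>m k * Q k) \<noteq> 0" by metis
  \<comment> \<open>The line passes through \<open>shift_mat\<close> at 0 and through
    \<open>Y\<close> at 1.\<close>
  define W where "W s = mat N N (\<lambda>ij. shift_mat $$ ij + s * (Y $$ ij - shift_mat $$ ij))" for s :: complex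
  have Wc: "W s \<in> carrier_mat N N" for s by (simp add: W_def)
  have W0: "W 0 = shift_mat" using carrier_matD[OF Xc] by (intro eq_matI) (auto simp: W_def)
  have "(\<lambda>s. s) = poly [:0, 1 :: complex:]" by (rule ext) simp
  then have id: "(\<lambda>s. s) \<in> poly_funs" unfolding poly_funs_def by (rule range_eqI)
  have W: "W \<in> polys.mats N N"
    unfolding polys.mats_def W_def using polys.add[OF polys.const polys.mult[OF id polys.const]] by simp
  have "\<forall>k. \<exists>p. (\<lambda>s. det (P k * W s ^\<^sub>m k * Q k)) = poly p"
  proof
    fix k
    have "(\<lambda>s. det (P k * W s ^\<^sub>m k * Q k)) \<in> poly_funs"
      by (intro polys.det_mats[of _ "N - b k"] polys.mats_mult[of _ _ N] polys.mats_pow polys.mats_const PQ W)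
    then show "\<exists>p. (\<lambda>s. det (P k * W s ^\<^sub>m k * Q k)) = poly p" by (auto simp: poly_funs_def)
  qed
  then obtain p where p: "\<And>k. (\<lambda>s. det (P k * W s ^\<^sub>m k * Q k)) = poly (p k)" by metis
  have "poly (p k) 0 \<noteq> 0" for k using PQ(3)[of k] fun_cong[OF p[of k], of 0] W0 by simp
  then have p0: "p k \<noteq> 0" for k by (metis poly_0)
  \<comment> \<open>Only powers below \<open>K\<close> matter, as \<open>N - b k = 0\<close> from
    there on. Each minor is a nonzero polynomial, because its value at 0 is the minor of
    \<open>shift_mat\<close>.\<close>
  define B where "B = (\<Union>k<K. {s. poly (p k) s = 0})"
  have "finite B" unfolding B_def using poly_roots_finite[OF p0] by blast
  then obtain d where d: "d > 0" "\<And>s. s \<in> B \<Longrightarrow> s \<noteq> 1 \<Longrightarrow> d \<le> dist 1 s"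
    using finite_set_avoid[of B "1 :: complex"] by blast
  \<comment> \<open>The points tend to 1 without reaching it, since \<open>Y\<close> itself may have
    smaller ranks, and lie closer to 1 than any other point of \<open>B\<close>.\<close>
  define t where "t m = 1 + complex_of_real (d / real (Suc (Suc m)))" for m
  have t: "t m \<notin> B" for m
  proof
    assume "t m \<in> B"
    moreover have "t m \<noteq> 1" using d(1) by (simp add: t_def del: of_real_divide of_nat_Suc)
    ultimately have "d \<le> dist 1 (t m)" by (rule d(2))
    also have "dist 1 (t m) = d / real (Suc (Suc m))"
      using d(1) by (simp add: t_def dist_norm norm_divide del: of_nat_Suc)
    also have "\<dots> < d" using d(1) by (simp add: divide_less_eq)
    finally show False by simp
  qed
  have "(\<lambda>m. d / real (Suc (Suc m))) \<longlonglongrightarrow> 0"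
    using tendsto_mult_right_zero[OF LIMSEQ_Suc[OF LIMSEQ_inverse_real_of_nat], of d]
    by (simp add: divide_inverse)
  then have "t \<longlonglongrightarrow> 1 + complex_of_real 0"
    unfolding t_def by (intro tendsto_add tendsto_const tendsto_of_real)
  then have t_lim: "t \<longlonglongrightarrow> 1" by simp
  have "similar_mat (W (t m)) shift_mat" for m
  proof -
    have Wn: "W (t m) \<in> nilradical N b"
      using Y shift_mat_nilradical unfolding nilradical_def W_def by fastforce
    show ?thesis
    proof (rule similar_shift_mat[OF nilradical_nilpotent[OF Wn] similar_mat_refl[OF Wc] Wn])
      fix k
      show "rank_ge (N - b k) (W (t m) ^\<^sub>m k)"
      proof (cases "k < K")
        case True
        then have "poly (p k) (t m) \<noteq> 0" using t[of m] by (auto simp: B_def)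
        then have "det (P k * W (t m) ^\<^sub>m k * Q k) \<noteq> 0" using fun_cong[OF p[of k], of "t m"] by simp
        then show ?thesis by (rule rank_geI[OF pow_carrier_mat[OF Wc] PQ(1,2)])
      next
        case False
        then have "b k = N" using K b_mono[of K k] b_le[of k] by simp
        then show ?thesis using rank_ge_0[of "W (t m) ^\<^sub>m k"] Wc by simp
      qed
    qed
  qed
  moreover have "(\<lambda>m. W (t m) $$ (i, j)) \<longlonglongrightarrow> Y $$ (i, j)" if "i < N" "j < N" for i j
  proof -
    have "(\<lambda>m. shift_mat $$ (i, j) + t m * (Y $$ (i, j) - shift_mat $$ (i, j)))
        \<longlonglongrightarrow> shift_mat $$ (i, j) + 1 * (Y $$ (i, j) - shift_mat $$ (i, j))"
      by (intro tendsto_add tendsto_mult tendsto_const t_lim)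
    then show ?thesis using that by (simp add: W_def)
  qed
  ultimately show ?thesis using Wc by (intro exI[of _ "\<lambda>m. W (t m)"]) blast
qed

lemma conj_saturation_nilradical_subset_closure:
  "conj_saturation (nilradical N b) \<subseteq> mat_topology N closure_of conj_saturation {shift_mat}"
proof
  fix Z assume "Z \<in> conj_saturation (nilradical N b)"
  then obtain Y where Y: "Y \<in> nilradical N b" "similar_mat Z Y" unfolding conj_saturation_def by blast
  have Zc: "Z \<in> carrier_mat N N" by (rule similar_mat_carrier[OF Y(2) nilradical_carrier[OF Y(1)]])
  obtain g h where w: "similar_mat_wit Z Y g h" using Y(2) unfolding similar_mat_def by blast
  note gh = similar_mat_witD2[OF Zc w]
  obtain S where S: "\<And>m. S m \<in> carrier_mat N N" "\<And>m. similar_mat (S m) shift_mat"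
    "\<And>i j. i < N \<Longrightarrow> j < N \<Longrightarrow> (\<lambda>m. S m $$ (i, j)) \<longlonglongrightarrow> Y $$ (i, j)"
    using nilradical_dense[OF Y(1)] by blast
  have "case_option Y S \<in> convs.mats N N" using gh S by (intro mats_case_option) auto
  then have lim: "(\<lambda>x. g * case_option Y S x * h) \<in> convs.mats N N"
    using gh by (intro convs.mats_mult convs.mats_const) auto
  show "Z \<in> mat_topology N closure_of conj_saturation {shift_mat}"
  proof (rule closure_of_matI[OF Zc])
    show "g * S m * h \<in> conj_saturation {shift_mat}" for m
    proof -
      have "similar_mat (g * S m * h) (S m)"
        by (rule similar_matI[of _ _ g h N]) (use gh S(1)[of m] in auto)
      then show ?thesis using S(2)[of m] similar_mat_trans by (auto simp: conj_saturation_def)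
    qed
    show "conj_saturation {shift_mat} \<subseteq> carrier_mat N N"
      using similar_mat_carrier[OF _ shift_mat_carrier] by (auto simp: conj_saturation_def)
    show "(\<lambda>m. (g * S m * h) $$ (i, j)) \<longlonglongrightarrow> Z $$ (i, j)" if "i < N" "j < N" for i j
      using convs.mats_index[OF lim that] unfolding gh(3)
      by (simp add: convergent_funs_def del: index_mult_mat(1))
  qed
qed

end

section \<open>Identification of the associated orbit\<close>

text \<open>The class of \<open>shift_mat\<close> is the only nilpotent class whose closure is the
  saturation, so the definite description in \<open>assoc_orbit\<close> denotes it.\<close>

lemma closure_assoc_orbit:
  assumes b: "block_bounds (n + 1) b" and I: "ad_nilpotent_ideal n I"
    and eq: "conj_saturation I = conj_saturation (nilradical (n + 1) b)"
  shows "mat_topology (n + 1) closure_of assoc_orbit n I = conj_saturation I"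
proof -
  interpret block_bounds "n + 1" b by (rule b)
  let ?N = "n + 1" and ?O = "conj_saturation {shift_mat}"
  have "?O \<subseteq> conj_saturation I"
    unfolding eq using shift_mat_nilradical by (auto simp: conj_saturation_def)
  then have "mat_topology ?N closure_of ?O \<subseteq> conj_saturation I"
    using closure_of_mono conj_saturation_closed[OF I] by blast
  then have cl: "mat_topology ?N closure_of ?O = conj_saturation I"
    using conj_saturation_nilradical_subset_closure eq by blast
  have nil: "nilpotent_class ?N ?O"
    using nilradical_nilpotent[OF shift_mat_nilradical] by (auto simp: nilpotent_class_def)
  have unique: "C = ?O" if C: "nilpotent_class ?N C" "mat_topology ?N closure_of C = conj_saturation I" for C
  proof -
    obtain Y where Y: "nilpotent_mat ?N Y" "C = conj_saturation {Y}"
      using C(1) unfolding nilpotent_class_def by blast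
    have Yc: "Y \<in> carrier_mat ?N ?N" using Y(1) by (simp add: nilpotent_mat_def)
    have Cc: "C \<subseteq> carrier_mat ?N ?N" unfolding Y(2) by (rule conj_saturation_subset_carrier) (use Yc in auto)
    have "C \<subseteq> mat_topology ?N closure_of C" by (rule closure_of_subset) (use Cc topspace_mat_topology in auto)
    then have "Y \<in> conj_saturation (nilradical ?N b)"
      using C(2) eq Y(2) similar_mat_refl[OF Yc] by (auto simp: conj_saturation_def)
    then obtain Y0 where Y0: "Y0 \<in> nilradical ?N b" "similar_mat Y Y0" unfolding conj_saturation_def by blast
    have "shift_mat \<in> ?O" using similar_mat_refl[OF shift_mat_carrier] by (simp add: conj_saturation_def)
    \<comment> \<open>As a limit of elements of \<open>C\<close>, \<open>shift_mat\<close> bounds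
      the ranks of powers on \<open>C\<close> from below by semicontinuity; \<open>Y0\<close> bounds
      them from above.\<close>
    then have X: "shift_mat \<in> mat_topology ?N closure_of C" using \<open>?O \<subseteq> _\<close> C(2) by blast
    have "similar_mat Y shift_mat"
    proof (rule similar_shift_mat[OF Y(1) Y0(2,1)])
      fix k
      obtain P Q where PQ: "P \<in> carrier_mat (?N - b k) ?N" "Q \<in> carrier_mat ?N (?N - b k)"
        "det (P * shift_mat ^\<^sub>m k * Q) \<noteq> 0"
        using shift_mat_rank[of k]
        unfolding rank_ge_def carrier_matD[OF pow_carrier_mat[OF shift_mat_carrier]] by blast
      obtain Z where Z: "Z \<in> C" "det (P * Z ^\<^sub>m k * Q) \<noteq> 0"
        using det_closure_of_nonzero[OF X Cc PQ] by blast
      have "Z ^\<^sub>m k \<in> carrier_mat ?N ?N" using Z(1) Cc by auto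
      then have "rank_ge (?N - b k) (Z ^\<^sub>m k)" using PQ(1,2) Z(2) by (rule rank_geI)
      moreover have "similar_mat Z Y" using Z(1) Y(2) by (simp add: conj_saturation_def)
      ultimately show "rank_ge (?N - b k) (Y ^\<^sub>m k)" using rank_ge_pow_similar Z(1) Cc by blast
    qed
    then show ?thesis
      unfolding Y(2) conj_saturation_def using similar_mat_trans similar_mat_sym by blast
  qed
  have "nilpotent_class ?N (assoc_orbit n I) \<and>
      mat_topology ?N closure_of (assoc_orbit n I) = conj_saturation I"
    unfolding assoc_orbit_def
  proof (rule theI)
    show "nilpotent_class ?N ?O \<and> mat_topology ?N closure_of ?O = conj_saturation I"
      using nil cl by blast
    fix C assume "nilpotent_class ?N C \<and> mat_topology ?N closure_of C = conj_saturation I"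
    then show "C = ?O" using unique by blast
  qed
  then show ?thesis by blast
qed

text \<open>The \<open>k\<close>-th power of \<open>shift_mat\<close> for \<open>b\<close> has rank
  \<open>N - b k\<close>, which cannot exceed the bound \<open>N - c k\<close> on the other
  nilradical.\<close>

lemma block_bounds_le:
  assumes b: "block_bounds N b" and c: "block_bounds N c"
    and sub: "nilradical N b \<subseteq> conj_saturation (nilradical N c)"
  shows "c k \<le> b k"
proof -
  interpret b: block_bounds N b by (rule b)
  interpret c: block_bounds N c by (rule c)
  obtain Y where Y: "Y \<in> nilradical N c" "similar_mat b.shift_mat Y"
    using sub b.shift_mat_nilradical unfolding conj_saturation_def by blast
  have "rank_ge (N - b k) (Y ^\<^sub>m k)"
    using b.shift_mat_rank[of k] rank_ge_pow_similar[OF Y(2) b.shift_mat_carrier] by blast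
  then have "N - b k \<le> N - c k" by (rule c.nilradical_rank_le[OF Y(1)])
  then show ?thesis using b.b_le[of k] c.b_le[of k] by linarith
qed

section \<open>From ideals to sorted nilradicals\<close>

text \<open>Each block prepends its starting boundary. The bound on \<open>b 1\<close> is carried
  along to obtain concavity at the newly added boundary.\<close>

lemma sorted_blocks_bounds:
  assumes "sorted_blocks N m P g"
  shows "\<exists>b. b 0 = P \<and> (\<forall>i. b i \<le> b (Suc i)) \<and> (\<forall>i. b (Suc (Suc i)) + b i \<le> 2 * b (Suc i)) \<and>
    b 1 \<le> P + m \<and> (\<forall>i. b i \<le> N) \<and> (\<exists>i. b i = N) \<and>
    (\<forall>x\<in>{P<..N}. \<exists>i. b i < x \<and> x \<le> b (Suc i) \<and> g x = b i)"
  using assms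
proof (induction rule: sorted_blocks.induct)
  case (Nil m g)
  show ?case by (intro exI[of _ "\<lambda>_. N"]) auto
next
  case (Cons k m P g)
  then obtain b where b: "b 0 = P + k" "\<forall>i. b i \<le> b (Suc i)" "\<forall>i. b (Suc (Suc i)) + b i \<le> 2 * b (Suc i)"
    "b 1 \<le> P + k + k" "\<forall>i. b i \<le> N" "\<exists>i. b i = N"
    "\<forall>x\<in>{P + k<..N}. \<exists>i. b i < x \<and> x \<le> b (Suc i) \<and> g x = b i" by blast
  define c where "c = case_nat P b"
  have c: "c 0 = P" "c (Suc i) = b i" for i by (simp_all add: c_def)
  show ?case
  proof (intro exI[of _ c] conjI allI ballI)
    show "c i \<le> c (Suc i)" for i using b(1,2) by (cases i) (auto simp: c)
    show "c (Suc (Suc i)) + c i \<le> 2 * c (Suc i)" for i using b(1,3,4) by (cases i) (auto simp: c)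
    show "c i \<le> N" for i using b(5) Cons by (cases i) (auto simp: c)
    show "\<exists>i. c i = N" using b(6) c(2) by metis
    show "\<exists>i. c i < x \<and> x \<le> c (Suc i) \<and> g x = c i" if "x \<in> {P<..N}" for x
    proof (cases "x \<le> P + k")
      case True
      then show ?thesis using that Cons b(1) by (intro exI[of _ 0]) (auto simp: c)
    next
      case False
      then have "x \<in> {P + k<..N}" using that by simp
      then obtain i where "b i < x \<and> x \<le> b (Suc i) \<and> g x = b i" using b(7) by blast
      then show ?thesis by (intro exI[of _ "Suc i"]) (simp add: c)
    qed
  qed (use Cons b(1) c in auto)
qed

lemma root_ideal_is_roots_of:
  assumes R: "root_ideal n R"
  shows "\<exists>f. hess n f \<and> R = roots_of n f"
proof -
  have pos: "1 \<le> i" "i \<le> j" "j \<le> n" if "(i, j) \<in> R" for i j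
    using R that by (auto simp: root_ideal_def pos_roots_def)
  have up: "(i', j') \<in> R" if "(i, j) \<in> R" "1 \<le> i'" "i' \<le> i" "j \<le> j'" "j' \<le> n" for i j i' j'
  proof -
    have "(i', j') \<in> pos_roots n" "root_le (i, j) (i', j')"
      using that pos[OF that(1)] by (auto simp: pos_roots_def root_le_def)
    then show ?thesis using R that(1) unfolding root_ideal_def by blast
  qed
  \<comment> \<open>The height is the lowest row met in column \<open>x\<close>; the disjunct
    \<open>i = 0\<close> supplies the value for an empty column.\<close>
  define f where "f x = (GREATEST i. i = 0 \<or> (i, x - 1) \<in> R)" for x
  have f_mem: "f x = 0 \<or> (f x, x - 1) \<in> R" for x
    unfolding f_def by (rule GreatestI_nat[of _ 0 n]) (use pos in fastforce)+
  have f_ge: "i \<le> f x" if "(i, x - 1) \<in> R" for i x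
    unfolding f_def by (rule Greatest_le_nat[of _ _ n]) (use pos that in fastforce)+
  have "hess n f"
    unfolding hess_def
  proof (intro ballI conjI)
    fix x assume x: "x \<in> {1..n + 1}"
    show "f x < x" using f_mem[of x] pos[of "f x" "x - 1"] x by auto
    fix y assume y: "y \<in> {x..n + 1}"
    show "f x \<le> f y"
      using f_mem[of x]
    proof
      assume mem: "(f x, x - 1) \<in> R"
      have "(f x, y - 1) \<in> R"
        by (rule up[OF mem]) (use pos[OF mem] x y in auto)
      then show ?thesis by (rule f_ge)
    qed simp
  qed
  moreover have "(i, j) \<in> R \<longleftrightarrow> (i, j) \<in> roots_of n f" for i j
  proof
    assume mem: "(i, j) \<in> R"
    then have "i \<le> f (j + 1)" by (intro f_ge) simp
    then show "(i, j) \<in> roots_of n f" using pos[OF mem] by (simp add: roots_of_def)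
  next
    assume "(i, j) \<in> roots_of n f"
    then have ij: "1 \<le> i" "j \<le> n" "i \<le> f (j + 1)" by (auto simp: roots_of_def)
    then have "(f (j + 1), j) \<in> R" using f_mem[of "j + 1"] by auto
    then show "(i, j) \<in> R" by (rule up) (use ij in auto)
  qed
  ultimately show ?thesis by auto
qed

lemma conn_basic_moves:
  assumes "conn n f g"
  shows "equivclp (basic_move n) (root_space_sum n (roots_of n f)) (root_space_sum n (roots_of n g))"
  using assms
proof (induction rule: equivclp_induct)
  case (step g h)
  have "basic_move n (root_space_sum n (roots_of n f)) (root_space_sum n (roots_of n g))"
    if "hess_move n f g" for f g
    using that unfolding hess_move_def basic_move_def by blast
  then show ?case using step equivclp_into_equivclp by metis
qed simp

lemma ideal_equiv_nilradical:
  assumes I: "ad_nilpotent_ideal n I"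
  obtains b where "block_bounds (n + 1) b" "equivclp (basic_move n) I (nilradical (n + 1) b)"
proof -
  obtain R where R: "root_ideal n R" "I = root_space_sum n R" using ideal_is_root_space_sum[OF I] by blast
  obtain f where f: "hess n f" "R = roots_of n f" using root_ideal_is_roots_of[OF R(1)] by blast
  obtain g where g: "conn n f g" "sorted_blocks (n + 1) (n + 1) 0 g"
    using conn_sorted_blocks[OF f(1), of 0] by auto
  obtain b where b: "b 0 = 0" "\<And>i. b i \<le> b (Suc i)" "\<And>i. b (Suc (Suc i)) + b i \<le> 2 * b (Suc i)"
    "\<And>i. b i \<le> n + 1" "\<exists>i. b i = n + 1"
    "\<And>x. x \<in> {0<..n + 1} \<Longrightarrow> \<exists>i. b i < x \<and> x \<le> b (Suc i) \<and> g x = b i"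
    using sorted_blocks_bounds[OF g(2)] by blast
  have bb: "block_bounds (n + 1) b" by unfold_locales (use b in auto)
  interpret block_bounds "n + 1" b by (rule bb)
  \<comment> \<open>Only the last boundary at or before \<open>q\<close> matters, and this is
    \<open>g (q + 1)\<close>, the height of that column counted from 1.\<close>
  have pos: "(p + 1, q) \<in> roots_of n g \<longleftrightarrow> (\<exists>i. p < b i \<and> b i \<le> q)" if q: "q < n + 1" for p q
  proof -
    obtain i where i: "b i < q + 1" "q + 1 \<le> b (Suc i)" "g (q + 1) = b i" using b(6)[of "q + 1"] q by auto
    have "b j \<le> b i" if "b j \<le> q" for j
    proof (rule ccontr)
      assume "\<not> b j \<le> b i"
      then have "\<not> j \<le> i" using b_mono by blast
      then have "b (Suc i) \<le> b j" by (intro b_mono) simp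
      then show False using i(2) that by simp
    qed
    moreover have "b i \<le> q" using i(1) by simp
    ultimately have "(\<exists>j. p < b j \<and> b j \<le> q) \<longleftrightarrow> p < b i"
      using less_le_trans by blast
    then show ?thesis using i(3) q by (auto simp: roots_of_def)
  qed
  have "root_space_sum n (roots_of n g) = nilradical (n + 1) b"
    unfolding root_space_sum_def nilradical_def using pos by auto
  then have "equivclp (basic_move n) I (nilradical (n + 1) b)"
    using conn_basic_moves[OF g(1)] R(2) f(2) by simp
  then show thesis using that bb by blast
qed

theorem theorem2p2:
  fixes n :: nat and I J :: "complex mat set"
  assumes "n \<ge> 1"
    and "ad_nilpotent_ideal n I"
    and "ad_nilpotent_ideal n J"
  shows "equivclp (basic_move n) I J \<longleftrightarrow> assoc_orbit n I = assoc_orbit n J"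
proof
  assume "equivclp (basic_move n) I J"
  then show "assoc_orbit n I = assoc_orbit n J"
    unfolding assoc_orbit_def by (simp only: equivclp_conj_saturation)
next
  assume eq: "assoc_orbit n I = assoc_orbit n J"
  let ?N = "n + 1"
  obtain b where b: "block_bounds ?N b" "equivclp (basic_move n) I (nilradical ?N b)"
    using ideal_equiv_nilradical[OF assms(2)] .
  obtain c where c: "block_bounds ?N c" "equivclp (basic_move n) J (nilradical ?N c)"
    using ideal_equiv_nilradical[OF assms(3)] .
  have sat: "conj_saturation I = conj_saturation (nilradical ?N b)"
    "conj_saturation J = conj_saturation (nilradical ?N c)"
    using equivclp_conj_saturation[OF b(2)] equivclp_conj_saturation[OF c(2)] by auto
  \<comment> \<open>Each saturation is recovered from its orbit as the closure.\<close>
  have "conj_saturation I = conj_saturation J"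
    using closure_assoc_orbit[OF b(1) assms(2) sat(1)] closure_assoc_orbit[OF c(1) assms(3) sat(2)] eq
    by simp
  then have same: "conj_saturation (nilradical ?N b) = conj_saturation (nilradical ?N c)"
    using sat by simp
  have sub: "nilradical ?N d \<subseteq> conj_saturation (nilradical ?N d)" for d
    using similar_mat_refl nilradical_carrier unfolding conj_saturation_def by blast
  \<comment> \<open>Mutual containment of the saturations compares maximal ranks both ways, so both
    ideals are connected to the same nilradical.\<close>
  have "b k = c k" for k
    using block_bounds_le[OF b(1) c(1), of k] block_bounds_le[OF c(1) b(1), of k] sub[of b] sub[of c] same
    by (simp add: le_antisym)
  then have "b = c" by blast
  then show "equivclp (basic_move n) I J"
    using b(2) c(2) by (metis equivclp_sym equivclp_trans)
qed

end
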